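(* (Interaction $\sigma_3\otimes\sigma_1$.) Let $g,\omega_a,\omega_b\in\mathbb{R}$ with $g\neq0$ and $\omega_b\neq0$, let $H_I=\frac g2\sigma_3\otimes\sigma_1$, and consider the controlled two-qubit master equation $\dot\rho=-i[H(u(t)),\rho]+\mathcal{L}(\rho)$ of the context. Let $\epsilon>0$, let $u:[0,\epsilon]\to\mathbb{R}^3$ be a piecewise-$C^\infty$ control, and let $\rho(t)$ be a corresponding solution with $\rho(0)\in\mathcal{P}$ such that $\mathrm{Tr}\big((\mathrm{Tr}_A\rho(t))^2\big)=1$ for all $t\in[0,\epsilon]$. Then: (i) $v^A_1(t)=v^A_2(t)=0$ and $(v^A_3(t))^2=\frac14$ for all $t\in[0,\epsilon]$; (ii) $v^A_3\,\hat d_{33}+\frac{(\mathbf{v}_0)_3}{2}=0$; (iii) at every continuity point of the control, $$u_1=\frac{(\mathbf{v}_0)_2+2v^A_3\,\hat d_{23}}{2v^A_3},\qquad u_2=-\frac{(\mathbf{v}_0)_1+2v^A_3\,\hat d_{13}}{2v^A_3};$$ (iv) $v^B$ satisfies the equation (which does not involve the control) $$\dot v^B_1=-\omega_b v^B_2,\qquad \dot v^B_2=\omega_b v^B_1-2g v^A_3 v^B_3,\qquad \dot v^B_3=2g v^A_3 v^B_2 .$$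
   Context: $\mathcal{P}$ is the set of density matrices (Hermitian, positive semidefinite, trace one) on $\mathbb{C}^2\otimes\mathbb{C}^2$ (first factor $A$, second factor $B$); $\mathrm{Tr}_A$, $\mathrm{Tr}_B$ are the partial traces over the first and second factor; $\sigma_1,\sigma_2,\sigma_3$ are the Pauli matrices. Hamiltonian: $H(u)=\frac12\big(\omega_a\sigma_3+\sum_{j=1}^3u_j\sigma_j\big)\otimes I_2+H_I+I_2\otimes\frac{\omega_b}{2}\sigma_3$. Dissipation: $\mathcal{L}(\rho)=\sum_k\big(L_k\rho L_k^\dagger-\frac12L_k^\dagger L_k\rho-\frac12\rho L_k^\dagger L_k\big)$, a finite sum with $L_k=\ell_k\otimes I_2$, each $\ell_k$ a traceless complex $2\times2$ matrix. For a state $\rho$, set $v^A_i=\frac12\mathrm{Tr}\big(\rho(\sigma_i\otimes I_2)\big)$ and $v^B_j=\frac12\mathrm{Tr}\big(\rho(I_2\otimes\sigma_j)\big)$, so that $\mathrm{Tr}_B\rho=\frac12I_2+\sum_iv^A_i\sigma_i$ and $\mathrm{Tr}_A\rho=\frac12I_2+\sum_jv^B_j\sigma_j$. With $\mathcal{L}_A(X)=\sum_k\big(\ell_kX\ell_k^\dagger-\frac12\ell_k^\dagger\ell_kX-\frac12X\ell_k^\dagger\ell_k\big)$ on $2\times2$ matrices, set $\hat d_{ij}=\frac12\mathrm{Tr}\big(\sigma_i\mathcal{L}_A(\sigma_j)\big)$ and $(\mathbf{v}_0)_i=\frac12\mathrm{Tr}\big(\sigma_i\mathcal{L}_A(I_2)\big)$,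 $i,j=1,2,3$. *)

theory Defs
  imports "HOL-Analysis.Analysis"
begin

type_synonym qubit_mat = "complex^2^2"
type_synonym two_qubit_mat = "complex^(2 \<times> 2)^(2 \<times> 2)"

definition cscale :: "complex \<Rightarrow> complex^'n^'m \<Rightarrow> complex^'n^'m" where
  "cscale c M = (\<chi> i j. c * M $ i $ j)"

definition dagger :: "complex^'n^'m \<Rightarrow> complex^'m^'n" where
  "dagger M = (\<chi> i j. cnj (M $ j $ i))"

definition density_matrices :: "(complex^'n^'n) set" where
  "density_matrices = {\<rho>. dagger \<rho> = \<rho>
     \<and> (\<forall>x :: complex^'n. 0 \<le> Re (\<Sum>i\<in>UNIV. \<Sum>j\<in>UNIV. cnj (x $ i) * \<rho> $ i $ j * x $ j))
     \<and> trace \<rho> = 1}"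

definition commutator :: "complex^'n^'n \<Rightarrow> complex^'n^'n \<Rightarrow> complex^'n^'n" where
  "commutator M N = M ** N - N ** M"

definition kron :: "qubit_mat \<Rightarrow> qubit_mat \<Rightarrow> two_qubit_mat" where
  "kron M N = (\<chi> p q. M $ fst p $ fst q * N $ snd p $ snd q)"

definition ptrace_A :: "two_qubit_mat \<Rightarrow> qubit_mat" where
  "ptrace_A \<rho> = (\<chi> j j'. \<Sum>i\<in>UNIV. \<rho> $ (i, j) $ (i, j'))"

text \<open>The index type \<open>3\<close> has the elements \<open>1\<close>, \<open>2\<close>, \<open>3\<close> (with \<open>3 = 0\<close>).\<close>

definition pauli :: "3 \<Rightarrow> qubit_mat" where
  "pauli j =
     (if j = 1 then vector [vector [0, 1], vector [1, 0]]
      else if j = 2 then vector [vector [0, - \<i>], vector [\<i>, 0]]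
      else vector [vector [1, 0], vector [0, - 1]])"

definition hamiltonian :: "real \<Rightarrow> real \<Rightarrow> two_qubit_mat \<Rightarrow> real^3 \<Rightarrow> two_qubit_mat" where
  "hamiltonian \<omega>a \<omega>b HI u =
     kron ((1/2) *\<^sub>R (\<omega>a *\<^sub>R pauli 3 + (\<Sum>j\<in>UNIV. u $ j *\<^sub>R pauli j))) (mat 1)
     + HI
     + kron (mat 1) ((\<omega>b / 2) *\<^sub>R pauli 3)"

definition dissipator :: "nat \<Rightarrow> (nat \<Rightarrow> complex^'n^'n) \<Rightarrow> complex^'n^'n \<Rightarrow> complex^'n^'n" where
  "dissipator m L X =
     (\<Sum>k<m. L k ** X ** dagger (L k)
        - (1/2) *\<^sub>R (dagger (L k) ** L k ** X)
        - (1/2) *\<^sub>R (X ** dagger (L k) ** L k))"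

definition master_rhs ::
  "real \<Rightarrow> real \<Rightarrow> two_qubit_mat \<Rightarrow> nat \<Rightarrow> (nat \<Rightarrow> qubit_mat) \<Rightarrow> real^3 \<Rightarrow> two_qubit_mat \<Rightarrow> two_qubit_mat"
  where
  "master_rhs \<omega>a \<omega>b HI m l u \<rho> =
     cscale (- \<i>) (commutator (hamiltonian \<omega>a \<omega>b HI u) \<rho>)
     + dissipator m (\<lambda>k. kron (l k) (mat 1)) \<rho>"

text \<open>
  Smoothness on a closed interval is taken with one-sided derivatives at the endpoints.
  A function is piecewise smooth if its restriction to each open piece of some finite
  partition extends smoothly to the closed piece; its values at the breakpoints are arbitrary.
\<close>

definition smooth_on_interval :: "real \<Rightarrow> real \<Rightarrow> (real \<Rightarrow> 'a::real_normed_vector) \<Rightarrow> bool" where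
  "smooth_on_interval a b f \<longleftrightarrow>
     (\<exists>D :: nat \<Rightarrow> real \<Rightarrow> 'a. (\<forall>t\<in>{a..b}. D 0 t = f t)
        \<and> (\<forall>n. \<forall>t\<in>{a..b}. (D n has_vector_derivative D (Suc n) t) (at t within {a..b})))"

definition piecewise_smooth_on :: "real \<Rightarrow> real \<Rightarrow> (real \<Rightarrow> 'a::real_normed_vector) \<Rightarrow> bool" where
  "piecewise_smooth_on a b f \<longleftrightarrow>
     (\<exists>(n::nat) p. p 0 = a \<and> p n = b \<and> (\<forall>i<n. p i < p (Suc i))
        \<and> (\<forall>i<n. \<exists>h. smooth_on_interval (p i) (p (Suc i)) h
                 \<and> (\<forall>t\<in>{p i<..<p (Suc i)}. f t = h t)))"

text \<open>
  The control may jump, so a solution is a continuous curve that satisfies the equation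
  outside finitely many times.
\<close>

definition is_solution ::
  "real \<Rightarrow> real \<Rightarrow> two_qubit_mat \<Rightarrow> nat \<Rightarrow> (nat \<Rightarrow> qubit_mat) \<Rightarrow> real
    \<Rightarrow> (real \<Rightarrow> real^3) \<Rightarrow> (real \<Rightarrow> two_qubit_mat) \<Rightarrow> bool" where
  "is_solution \<omega>a \<omega>b HI m l \<epsilon> u \<rho> \<longleftrightarrow>
     continuous_on {0..\<epsilon>} \<rho>
     \<and> (\<exists>S. finite S \<and> (\<forall>t\<in>{0..\<epsilon>} - S.
          (\<rho> has_vector_derivative master_rhs \<omega>a \<omega>b HI m l (u t) (\<rho> t)) (at t within {0..\<epsilon>})))"

text \<open>
  The trace formulas are complex-valued as written; the values are real for Hermitian \<open>\<rho>\<close>,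
  respectively because \<open>dissipator\<close> preserves Hermiticity.
\<close>

definition vA :: "two_qubit_mat \<Rightarrow> 3 \<Rightarrow> complex" where
  "vA \<rho> i = trace (\<rho> ** kron (pauli i) (mat 1)) / 2"

definition vB :: "two_qubit_mat \<Rightarrow> 3 \<Rightarrow> complex" where
  "vB \<rho> j = trace (\<rho> ** kron (mat 1) (pauli j)) / 2"

definition d_hat :: "nat \<Rightarrow> (nat \<Rightarrow> qubit_mat) \<Rightarrow> 3 \<Rightarrow> 3 \<Rightarrow> complex" where
  "d_hat m l i j = trace (pauli i ** dissipator m l (pauli j)) / 2"

definition v0 :: "nat \<Rightarrow> (nat \<Rightarrow> qubit_mat) \<Rightarrow> 3 \<Rightarrow> complex" where
  "v0 m l i = trace (pauli i ** dissipator m l (mat 1)) / 2"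

end

theory Submission
  imports Defs
begin

text \<open>
  The GKSL flow preserves positivity, Hermiticity and trace, so \<open>\<rho>(t)\<close> is a state whose \<open>B\<close> marginal
  is pure; a positive matrix with a pure marginal is a product, \<open>\<rho>(t) = \<alpha>(t) \<otimes> \<beta>(t)\<close>.
  Let \<open>x\<close>, \<open>y\<close> be the Bloch vectors of \<open>\<alpha>\<close>, \<open>\<beta>\<close>. Differentiating the identity
  \<open>Tr(\<rho> (\<sigma>\<^sub>i \<otimes> \<sigma>\<^sub>j)) = x\<^sub>i y\<^sub>j\<close>, the local terms cancel, and what remains is
  \<open>(e\<^sub>3 \<times> x) \<otimes> (e\<^sub>1 - y\<^sub>1 y) + (e\<^sub>3 - x\<^sub>3 x) \<otimes> (e\<^sub>1 \<times> y) = 0\<close>.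
  Hence \<open>x = \<plusminus>e\<^sub>3\<close> unless \<open>y\<^sub>1\<^sup>2 = 1\<close>, and the precession of \<open>y\<close> about \<open>e\<^sub>3\<close> with \<open>\<omega>b \<noteq> 0\<close> excludes
  \<open>y\<^sub>1\<^sup>2 = 1\<close> on any interval. So \<open>x\<close> is constantly \<open>\<plusminus>e\<^sub>3\<close>, and its equation of motion
  yields the constraint on the dissipator and the control.
\<close>

section \<open>Positivity of the GKSL flow\<close>

text \<open>The product \<open>\<bullet>\<close> on complex vectors is the real part of the
  Hermitian one; the conjugate transpose is the adjoint for both.\<close>

lemma matrix_vector_inner_adjoint:
  fixes M :: "complex^'n^'m"
  shows "(M *v x) \<bullet> y = x \<bullet> (dagger M *v y)"
proof -
  have "(M *v x) \<bullet> y = (\<Sum>i\<in>UNIV. \<Sum>j\<in>UNIV. (M $ i $ j * x $ j) \<bullet> y $ i)"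
    by (simp add: inner_vec_def matrix_vector_mult_def inner_sum_left)
  also have "\<dots> = (\<Sum>j\<in>UNIV. \<Sum>i\<in>UNIV. x $ j \<bullet> (cnj (M $ i $ j) * y $ i))"
    by (subst sum.swap) (simp add: inner_complex_def algebra_simps)
  also have "\<dots> = x \<bullet> (dagger M *v y)"
    by (simp add: inner_vec_def matrix_vector_mult_def inner_sum_right dagger_def)
  finally show ?thesis .
qed

lemma dagger_dagger [simp]: "dagger (dagger M) = M"
  by (simp add: dagger_def vec_eq_iff)

lemma cscale_mult_vec: "cscale c M *v x = c *s (M *v x)"
  by (simp add: cscale_def matrix_vector_mult_def vec_eq_iff sum_distrib_left mult.assoc)

lemma mult_vec_cscale: "M *v (c *s x) = c *s (M *v (x :: complex^'n))"
  by (simp add: matrix_vector_mult_def vec_eq_iff sum_distrib_left mult_ac)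

lemma inner_scale_left: "(c *s x) \<bullet> y = x \<bullet> (cnj c *s (y :: complex^'n))"
  by (simp add: inner_vec_def inner_complex_def algebra_simps)

lemma scaleR_mult_vec: "(r *\<^sub>R M) *v x = r *\<^sub>R (M *v (x :: complex^'n))"
  by (simp add: matrix_vector_mult_def vec_eq_iff scaleR_sum_right)

lemma mult_vec_scaleR: "M *v (r *\<^sub>R x) = r *\<^sub>R (M *v (x :: complex^'n))"
  by (simp add: matrix_vector_mult_def vec_eq_iff scaleR_sum_right)

lemma sum_mult_vec: "(\<Sum>k\<in>A. M k) *v x = (\<Sum>k\<in>A. M k *v (x :: complex^'n))"
  by (induction A rule: infinite_finite_induct) (auto simp: matrix_vector_mult_add_rdistrib)

lemma mult_vec_sum: "M *v (\<Sum>k\<in>A. x k) = (\<Sum>k\<in>A. M *v (x k :: complex^'n))"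
  by (induction A rule: infinite_finite_induct) (auto simp: matrix_vector_right_distrib)

text \<open>Stated in any dimension, so that the same facts serve the two-qubit equation and the
  local generator of qubit A.\<close>

definition lindblad ::
  "complex^'n^'n \<Rightarrow> nat \<Rightarrow> (nat \<Rightarrow> complex^'n^'n) \<Rightarrow> complex^'n^'n \<Rightarrow> complex^'n^'n" where
  "lindblad h m L M = cscale (- \<i>) (commutator h M) + dissipator m L M"

text \<open>With \<open>K = - \<i> h - (1/2) (\<Sum>k. dagger (L k) ** L k)\<close> the generator is
  K M + M K' + sum of L M L', a prime denoting the adjoint, and \<open>y\<close> is K' x. Since
  \<open>y\<close> does not depend on \<open>M\<close>, the form at a null vector of a positive
  \<open>M\<close> reduces to the last, nonnegative sum.\<close>

lemma lindblad_quadratic_form: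
  fixes h :: "complex^'n^'n"
  assumes "dagger h = h"
  shows "\<exists>y. \<forall>M. x \<bullet> (lindblad h m L M *v x) =
    x \<bullet> (M *v y) + y \<bullet> (M *v x) + (\<Sum>k<m. (dagger (L k) *v x) \<bullet> (M *v (dagger (L k) *v x)))"
proof (intro exI allI)
  fix M :: "complex^'n^'n"
  let ?N = "\<lambda>k. dagger (L k) ** L k"
  let ?y = "\<i> *s (h *v x) - (1/2) *\<^sub>R (\<Sum>k<m. ?N k *v x)"
  have a: "x \<bullet> (h *v z) = (h *v x) \<bullet> z" for z
    by (simp add: matrix_vector_inner_adjoint assms)
  have H: "x \<bullet> (cscale (- \<i>) (commutator h M) *v x)
      = x \<bullet> (M *v (\<i> *s (h *v x))) + (\<i> *s (h *v x)) \<bullet> (M *v x)"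
  proof -
    have "x \<bullet> (cscale (- \<i>) (commutator h M) *v x)
        = x \<bullet> (h *v ((- \<i>) *s (M *v x))) + x \<bullet> (\<i> *s (M *v (h *v x)))"
      by (simp only: commutator_def cscale_mult_vec matrix_vector_mult_diff_rdistrib
          matrix_vector_mul_assoc[symmetric] inner_add_right[symmetric] mult_vec_cscale)
        (simp add: vec_eq_iff algebra_simps)
    then show ?thesis by (simp add: a inner_scale_left mult_vec_cscale)
  qed
  have n: "x \<bullet> (?N k *v z) = (?N k *v x) \<bullet> z" for k z
    by (simp add: matrix_vector_inner_adjoint matrix_vector_mul_assoc[symmetric])
  have D: "x \<bullet> ((L k ** M ** dagger (L k)
        - (1/2) *\<^sub>R (dagger (L k) ** L k ** M)
        - (1/2) *\<^sub>R (M ** dagger (L k) ** L k)) *v x)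
      = (dagger (L k) *v x) \<bullet> (M *v (dagger (L k) *v x))
        - (1/2) * ((?N k *v x) \<bullet> (M *v x)) - (1/2) * (x \<bullet> (M *v (?N k *v x)))" for k
    using n[of k "M *v x"]
    by (simp add: matrix_vector_mult_diff_rdistrib scaleR_mult_vec inner_diff_right
        matrix_vector_mul_assoc[symmetric] matrix_vector_inner_adjoint[of "dagger (L k)" x])
  show "x \<bullet> (lindblad h m L M *v x) =
    x \<bullet> (M *v ?y) + ?y \<bullet> (M *v x) + (\<Sum>k<m. (dagger (L k) *v x) \<bullet> (M *v (dagger (L k) *v x)))"
    by (simp only: lindblad_def dissipator_def matrix_vector_mult_add_rdistrib inner_add_right H
        sum_mult_vec inner_sum_right D)
      (simp add: sum_subtractf matrix_vector_mult_diff_distrib inner_diff_right inner_diff_left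
        mult_vec_scaleR mult_vec_sum inner_sum_left inner_sum_right sum_divide_distrib)
qed

text \<open>Along the line x + s y the form is a quadratic polynomial in s that is nonnegative and
  vanishes at s = 0, so its linear coefficient is zero.\<close>

lemma psd_isotropic_vector:
  fixes M :: "complex^'n^'n"
  assumes psd: "\<And>z. 0 \<le> z \<bullet> (M *v z)" and x: "x \<bullet> (M *v x) = 0"
  shows "x \<bullet> (M *v y) + y \<bullet> (M *v x) = 0"
proof -
  define b c where "b = x \<bullet> (M *v y) + y \<bullet> (M *v x)" and "c = y \<bullet> (M *v y)"
  have *: "0 \<le> s * b + s\<^sup>2 * c" for s
    using psd[of "x + s *\<^sub>R y"] x
    by (simp add: matrix_vector_right_distrib mult_vec_scaleR inner_add_left inner_add_right
        power2_eq_square algebra_simps b_def c_def)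
  have c: "0 \<le> c" unfolding c_def by (rule psd)
  have "b = 0"
  proof (rule ccontr)
    assume nz: "b \<noteq> 0"
    \<comment> \<open>The polynomial s b + s^2 c is negative at this point; adding 1 to c avoids
      division by zero when c = 0.\<close>
    let ?s = "- b / (c + 1)"
    have "?s * b + ?s\<^sup>2 * c = - (b\<^sup>2) / (c + 1)\<^sup>2"
      using c by (simp add: divide_simps power2_eq_square) (simp add: algebra_simps)
    also have "\<dots> < 0" using nz c by (simp add: divide_neg_pos)
    finally show False using *[of ?s] by linarith
  qed
  then show ?thesis by (simp add: b_def)
qed

section \<open>Linearity of the generator\<close>

lemma bounded_linear_quadratic_form:
  "bounded_linear (\<lambda>M :: complex^'n^'n. x \<bullet> (M *v y))"
  by (rule linear_conv_bounded_linear[THEN iffD1], rule linearI)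
    (simp_all add: matrix_vector_mult_add_rdistrib inner_add_right scaleR_mult_vec)

lemma cscale_add: "cscale c (A + B) = cscale c A + cscale c B"
  by (simp add: cscale_def vec_eq_iff algebra_simps)

lemma cscale_diff: "cscale c (A - B) = cscale c A - cscale c B"
  by (simp add: cscale_def vec_eq_iff algebra_simps)

lemma cscale_scaleR: "cscale c (r *\<^sub>R A) = r *\<^sub>R cscale c A"
  by (simp add: cscale_def vec_eq_iff)

lemma cscale_sum: "cscale c (\<Sum>k\<in>I. A k) = (\<Sum>k\<in>I. cscale c (A k))"
  by (simp add: cscale_def vec_eq_iff sum_distrib_left)

lemma mult_cscale: "A ** cscale c B = cscale c (A ** B)"
  by (simp add: cscale_def matrix_matrix_mult_def vec_eq_iff sum_distrib_left mult_ac)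

lemma cscale_mult: "cscale c A ** B = cscale c (A ** B)"
  by (simp add: cscale_def matrix_matrix_mult_def vec_eq_iff sum_distrib_left mult_ac)

lemma mult_add_left: "(A + B) ** C = A ** C + B ** (C :: complex^'n^'m)"
  by (simp add: matrix_matrix_mult_def vec_eq_iff sum.distrib algebra_simps)

lemma dissipator_add: "dissipator m L (M + N) = dissipator m L M + dissipator m L N"
  by (simp add: dissipator_def matrix_add_ldistrib mult_add_left sum.distrib[symmetric]
      scaleR_add_right algebra_simps)

lemma dissipator_cscale: "dissipator m L (cscale c M) = cscale c (dissipator m L M)"
  by (simp add: dissipator_def cscale_sum cscale_diff cscale_scaleR cscale_mult mult_cscale)

lemma lindblad_add: "lindblad h m L (M + N) = lindblad h m L M + lindblad h m L N"
  by (simp add: lindblad_def commutator_def dissipator_add matrix_add_ldistrib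
      mult_add_left cscale_diff cscale_add)

lemma lindblad_cscale: "lindblad h m L (cscale c M) = cscale c (lindblad h m L M)"
  by (simp add: lindblad_def commutator_def dissipator_cscale cscale_mult mult_cscale
      cscale_add cscale_diff) (simp add: cscale_def vec_eq_iff algebra_simps)

lemma cscale_of_real: "cscale (complex_of_real r) M = r *\<^sub>R M"
  by (simp add: cscale_def vec_eq_iff complex_eq_iff)

lemma lindblad_scaled_identity:
  "x \<bullet> (lindblad h m L (r *\<^sub>R mat 1) *v x) = r * (x \<bullet> (dissipator m L (mat 1) *v x))"
proof -
  have "lindblad h m L (mat 1) = dissipator m L (mat 1)"
    by (simp add: lindblad_def commutator_def cscale_def vec_eq_iff)
  then show ?thesis
    by (simp add: cscale_of_real[symmetric] lindblad_cscale)
      (simp add: cscale_of_real scaleR_mult_vec)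
qed

text \<open>Compactness of the unit sphere. The bound is strict so that the slope at a first exit
  time comes out strictly positive.\<close>

lemma quadratic_form_bounded_on_sphere:
  fixes M :: "complex^'n^'n"
  obtains c where "\<And>x. norm x = 1 \<Longrightarrow> x \<bullet> (M *v x) < c"
proof -
  have "continuous_on (sphere 0 1) (\<lambda>x. x \<bullet> (M *v x))"
    unfolding matrix_vector_mult_def by (intro continuous_intros)
  then have "compact ((\<lambda>x. x \<bullet> (M *v x)) ` sphere 0 1)"
    by (intro compact_continuous_image compact_sphere)
  then obtain B where "\<And>y. y \<in> (\<lambda>x. x \<bullet> (M *v x)) ` sphere 0 1 \<Longrightarrow> norm y \<le> B"
    by (meson bounded_iff compact_imp_bounded)
  then show ?thesis
    by (intro that[of "B + 1"]) (force simp: sphere_def)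
qed

lemma psd_of_unit_vectors:
  fixes M :: "complex^'n^'n"
  assumes "\<And>y. norm y = 1 \<Longrightarrow> 0 \<le> y \<bullet> (M *v y)"
  shows "0 \<le> x \<bullet> (M *v x)"
proof (cases "x = 0")
  case False
  have "0 \<le> ((1 / norm x) *\<^sub>R x) \<bullet> (M *v ((1 / norm x) *\<^sub>R x))"
    using False by (intro assms) simp
  also have "\<dots> = (x \<bullet> (M *v x)) / (norm x)\<^sup>2"
    by (simp add: mult_vec_scaleR power2_eq_square)
  finally show ?thesis using False by (simp add: zero_le_divide_iff)
qed simp

text \<open>
  First-exit argument for \<open>\<rho>(t) + \<delta> e\<^sup>c\<^sup>t I\<close>; since \<open>[h, I] = 0\<close>, the constant \<open>c\<close> depends only on
  the dissipator. Positivity is meant for \<open>x \<bullet> (M *v x)\<close>, the real part of \<open>\<langle>x, M x\<rangle>\<close>, which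
  makes sense for non-Hermitian \<open>M\<close> and allows the argument to be run on \<open>\<i> \<rho>\<close> as well.
\<close>

lemma lindblad_positive_open:
  fixes \<rho> :: "real \<Rightarrow> complex^'n^'n"
  assumes cont: "continuous_on {a..<b} \<rho>"
    and deriv: "\<And>t. t \<in> {a<..<b} \<Longrightarrow> (\<rho> has_vector_derivative lindblad (h t) m L (\<rho> t)) (at t)"
    and herm: "\<And>t. dagger (h t) = h t"
    and init: "\<And>x. 0 \<le> x \<bullet> (\<rho> a *v x)"
    and t1: "t1 \<in> {a..<b}"
  shows "0 \<le> x \<bullet> (\<rho> t1 *v x)"
proof -
  obtain c where c: "\<And>x. norm x = 1 \<Longrightarrow> x \<bullet> (dissipator m L (mat 1) *v x) < c"
    by (rule quadratic_form_bounded_on_sphere) blast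
  have unit: "x \<bullet> x = 1" if "norm x = 1" for x :: "complex^'n"
    using that by (simp add: dot_square_norm)
  have pos: "0 < x \<bullet> (\<rho> t *v x) + \<delta> * exp (c * t)"
    if \<delta>: "\<delta> > 0" and t: "t \<in> {a..t1}" and x: "norm x = 1" for \<delta> t x
  proof (rule ccontr)
    assume neg: "\<not> 0 < x \<bullet> (\<rho> t *v x) + \<delta> * exp (c * t)"
    define F where "F = (\<lambda>(t, x). x \<bullet> (\<rho> t *v x) + \<delta> * exp (c * t))"
    let ?K = "{a..t1} \<times> sphere (0 :: complex^'n) 1"
    let ?Z = "{p \<in> ?K. F p \<le> 0}"
    have sub: "{a..t1} \<subseteq> {a..<b}" using t1 by auto
    have contK: "continuous_on ?K F"
      unfolding F_def case_prod_beta matrix_vector_mult_def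
      by (intro continuous_intros continuous_on_compose2[OF continuous_on_subset[OF cont sub]]) auto
    have K: "compact ?K" by (intro compact_Times compact_sphere compact_Icc)
    \<comment> \<open>The set of times and unit vectors where the shifted form is not positive is
      compact, so it has an earliest time \<open>t0\<close>, attained with a vector
      \<open>x0\<close>.\<close>
    have "closed ?Z"
      using continuous_closed_preimage[OF contK compact_imp_closed[OF K], of "{..0}"]
      by (simp add: vimage_def Int_def)
    from compact_Int_closed[OF K this] have "compact (?K \<inter> ?Z)" .
    also have "?K \<inter> ?Z = ?Z" by auto
    finally have "compact ?Z" .
    then have "compact (fst ` ?Z)"
      by (intro compact_continuous_image continuous_intros)
    moreover have "(t, x) \<in> ?Z" using neg t x by (auto simp: F_def)
    then have "fst ` ?Z \<noteq> {}" by blast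
    ultimately have "\<exists>t0\<in>fst ` ?Z. \<forall>s\<in>fst ` ?Z. t0 \<le> s"
      by (rule compact_attains_inf)
    then obtain t0 where t0: "t0 \<in> fst ` ?Z" and least: "\<forall>s\<in>fst ` ?Z. t0 \<le> s"
      by (elim bexE)
    from t0 obtain p where p: "t0 = fst p" "p \<in> ?Z" by (rule imageE)
    define x0 where "x0 = snd p"
    have x0: "t0 \<in> {a..t1}" "norm x0 = 1" "F (t0, x0) \<le> 0"
      using p(2) by (simp_all add: p(1) x0_def mem_Times_iff del: atLeastAtMost_iff)
    have before: "0 < F (s, y)" if "a \<le> s" "s < t0" "norm y = 1" for s y
    proof (rule ccontr)
      assume "\<not> 0 < F (s, y)"
      then have "(s, y) \<in> ?Z" using that x0 by simp
      then have "s \<in> fst ` ?Z" by (rule image_eqI[rotated]) simp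
      with least have "t0 \<le> s" by (rule bspec)
      then show False using that by simp
    qed
    have "0 < F (a, x0)" using \<delta> init[of x0] by (simp add: F_def add_nonneg_pos)
    then have "t0 \<noteq> a" using x0(3) by auto
    then have "a < t0" "t0 < b" using x0 t1 by auto
    \<comment> \<open>Strict positivity before \<open>t0\<close> passes to the limit, so the shifted
      matrix is still positive at \<open>t0\<close> and \<open>x0\<close> is a null vector of
      it.\<close>
    have at0: "0 \<le> F (t0, y)" if y: "norm y = 1" for y
    proof -
      have "continuous_on {a..t0} (\<lambda>s. F (s, y))"
        using x0 y by (intro continuous_on_compose2[OF contK] continuous_intros) auto
      then have "((\<lambda>s. F (s, y)) \<longlongrightarrow> F (t0, y)) (at t0 within {a..t0})"
        using \<open>a < t0\<close> by (simp add: continuous_on)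
      then have "((\<lambda>s. F (s, y)) \<longlongrightarrow> F (t0, y)) (at_left t0)"
        using \<open>a < t0\<close> by (simp add: at_within_Icc_at_left)
      moreover have "eventually (\<lambda>s. 0 \<le> F (s, y)) (at_left t0)"
        unfolding eventually_at_left[OF \<open>a < t0\<close>]
        using before y \<open>a < t0\<close> by (intro exI[of _ a]) (auto intro!: less_imp_le)
      ultimately show ?thesis by (rule tendsto_lowerbound) simp
    qed
    define M where "M = \<rho> t0 + (\<delta> * exp (c * t0)) *\<^sub>R mat 1"
    have MF: "y \<bullet> (M *v y) = F (t0, y)" if "norm y = 1" for y
      using unit[OF that]
      by (simp add: M_def F_def matrix_vector_mult_add_rdistrib scaleR_mult_vec inner_add_right)
    have psd: "0 \<le> z \<bullet> (M *v z)" for z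
    proof (rule psd_of_unit_vectors)
      show "0 \<le> y \<bullet> (M *v y)" if "norm y = 1" for y
        unfolding MF[OF that] by (rule at0[OF that])
    qed
    have null: "x0 \<bullet> (M *v x0) = 0"
      using at0[OF x0(2)] x0(3) unfolding MF[OF x0(2)] by (rule antisym[rotated])
    obtain y where y: "\<forall>M. x0 \<bullet> (lindblad (h t0) m L M *v x0) = x0 \<bullet> (M *v y) + y \<bullet> (M *v x0)
        + (\<Sum>k<m. (dagger (L k) *v x0) \<bullet> (M *v (dagger (L k) *v x0)))"
      by (rule exE[OF lindblad_quadratic_form[where h = "h t0" and x = x0 and m = m and L = L, OF herm]])
    have y': "x0 \<bullet> (lindblad (h t0) m L M *v x0) = x0 \<bullet> (M *v y) + y \<bullet> (M *v x0)
        + (\<Sum>k<m. (dagger (L k) *v x0) \<bullet> (M *v (dagger (L k) *v x0)))"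
      by (rule y[THEN spec])
    have "0 \<le> x0 \<bullet> (lindblad (h t0) m L M *v x0)"
      unfolding y' psd_isotropic_vector[OF psd null]
      by (simp add: sum_nonneg psd)
    also have "\<dots> = x0 \<bullet> (lindblad (h t0) m L (\<rho> t0) *v x0)
        + \<delta> * exp (c * t0) * (x0 \<bullet> (dissipator m L (mat 1) *v x0))"
      by (simp add: M_def lindblad_add matrix_vector_mult_add_rdistrib inner_add_right
          lindblad_scaled_identity)
    also have "\<dots> < x0 \<bullet> (lindblad (h t0) m L (\<rho> t0) *v x0) + \<delta> * exp (c * t0) * c"
      using c[OF x0(2)] \<delta> by simp
    finally have slope: "0 < x0 \<bullet> (lindblad (h t0) m L (\<rho> t0) *v x0) + \<delta> * (exp (c * t0) * c)"
      by (simp add: mult.assoc)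
    have "((\<lambda>s. x0 \<bullet> (\<rho> s *v x0)) has_real_derivative
        x0 \<bullet> (lindblad (h t0) m L (\<rho> t0) *v x0)) (at t0)"
      using bounded_linear.has_vector_derivative[OF bounded_linear_quadratic_form deriv]
        \<open>a < t0\<close> \<open>t0 < b\<close> by (simp add: has_real_derivative_iff_has_vector_derivative)
    moreover have "((\<lambda>s. \<delta> * exp (c * s)) has_real_derivative \<delta> * (exp (c * t0) * c)) (at t0)"
      by (auto intro!: derivative_eq_intros)
    ultimately have "((\<lambda>s. F (s, x0)) has_real_derivative
        x0 \<bullet> (lindblad (h t0) m L (\<rho> t0) *v x0) + \<delta> * (exp (c * t0) * c)) (at t0)"
      unfolding F_def by (auto intro: DERIV_add)
    \<comment> \<open>A positive slope makes the form at \<open>x0\<close> negative just before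
      \<open>t0\<close>, against the minimality of \<open>t0\<close>.\<close>
    from DERIV_pos_inc_left[OF this slope] obtain d where "d > 0"
      and d: "\<And>s. 0 < s \<Longrightarrow> s < d \<Longrightarrow> F (t0 - s, x0) < F (t0, x0)" by blast
    define s where "s = min (d / 2) (t0 - a)"
    have "0 < s" "s < d" "a \<le> t0 - s" "t0 - s < t0"
      using \<open>d > 0\<close> \<open>a < t0\<close> by (auto simp: s_def)
    then show False
      using d[of s] before[of "t0 - s" x0] x0 by auto
  qed
  show ?thesis
  proof (rule psd_of_unit_vectors, rule ccontr)
    fix y :: "complex^'n"
    assume y: "norm y = 1" and "\<not> 0 \<le> y \<bullet> (\<rho> t1 *v y)"
    \<comment> \<open>With this \<delta> the shifted form is exactly zero at \<open>t1\<close>,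
      contrary to \<open>pos\<close>.\<close>
    then have "0 < - (y \<bullet> (\<rho> t1 *v y)) / exp (c * t1)" by (simp add: divide_neg_pos)
    from pos[OF this, of t1 y] show False using t1 y by simp
  qed
qed

text \<open>Induction on the exceptional set: an interior exceptional time splits the interval, and
  positivity at the end of the left piece is the initial condition of the right one. The right
  endpoint, which the half-open version leaves out, is reached by continuity.\<close>

lemma lindblad_positive:
  fixes \<rho> :: "real \<Rightarrow> complex^'n^'n"
  assumes "finite S" and "continuous_on {a..b} \<rho>"
    and "\<And>t. t \<in> {a<..<b} - S \<Longrightarrow> (\<rho> has_vector_derivative lindblad (h t) m L (\<rho> t)) (at t)"
    and herm: "\<And>t. dagger (h t) = h t"
    and "\<And>x. 0 \<le> x \<bullet> (\<rho> a *v x)" and "t \<in> {a..b}"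
  shows "0 \<le> x \<bullet> (\<rho> t *v x)"
  using assms(1-3,5-)
proof (induction arbitrary: a b t x)
  case empty
  have pos: "0 \<le> x \<bullet> (\<rho> s *v x)" if "s \<in> {a..<b}" for s
  proof (rule lindblad_positive_open[where a = a and b = b and h = h and m = m and L = L])
    show "continuous_on {a..<b} \<rho>"
      by (rule continuous_on_subset[OF empty(1)]) auto
  qed (use empty herm that in auto)
  show ?case
  proof (cases "t = b \<and> a < b")
    case True
    have "continuous_on {a..b} (\<lambda>s. x \<bullet> (\<rho> s *v x))"
      by (intro bounded_linear.continuous_on[OF bounded_linear_quadratic_form] empty)
    then have "((\<lambda>s. x \<bullet> (\<rho> s *v x)) \<longlongrightarrow> x \<bullet> (\<rho> b *v x)) (at_left b)"
      using True by (auto simp: continuous_on at_within_Icc_at_left[symmetric])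
    moreover have "eventually (\<lambda>s. 0 \<le> x \<bullet> (\<rho> s *v x)) (at_left b)"
      using True pos by (subst eventually_at_left[of a]) (auto intro!: exI[of _ a])
    ultimately have "0 \<le> x \<bullet> (\<rho> b *v x)" by (rule tendsto_lowerbound) simp
    then show ?thesis using True by simp
  next
    case False
    then show ?thesis using pos[of t] empty by force
  qed
next
  case (insert p S)
  show ?case
  proof (cases "p \<in> {a<..<b}")
    case True
    have left: "0 \<le> x \<bullet> (\<rho> s *v x)" if "s \<in> {a..p}" for s x
    proof (rule insert.IH[OF _ _ insert.prems(3) that])
      show "continuous_on {a..p} \<rho>"
        by (rule continuous_on_subset[OF insert.prems(1)]) (use True in auto)
    qed (use True insert.prems(2) in auto)
    show ?thesis
    proof (cases "t \<le> p")
      case True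
      then show ?thesis using left insert.prems by simp
    next
      case False
      show ?thesis
      proof (rule insert.IH)
        show "continuous_on {p..b} \<rho>"
          by (rule continuous_on_subset[OF insert.prems(1)]) (use \<open>p \<in> {a<..<b}\<close> in auto)
        show "(\<rho> has_vector_derivative lindblad (h t) m L (\<rho> t)) (at t)"
          if "t \<in> {p<..<b} - S" for t
          using that \<open>p \<in> {a<..<b}\<close> by (intro insert.prems(2)) auto
        show "0 \<le> y \<bullet> (\<rho> p *v y)" for y
          using left[of p] \<open>p \<in> {a<..<b}\<close> by simp
        show "t \<in> {p..b}" using False insert.prems(4) by simp
      qed
    qed
  next
    case False
    then show ?thesis
      by (intro insert.IH[OF insert.prems(1) insert.prems(2) insert.prems(3,4)]) auto
  qed
qed

text \<open>The equation is linear, so positivity applies to \<rho> and to its negative.\<close>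

lemma lindblad_isotropic:
  fixes \<rho> :: "real \<Rightarrow> complex^'n^'n"
  assumes S: "finite S" and cont: "continuous_on {a..b} \<rho>"
    and deriv: "\<And>t. t \<in> {a<..<b} - S \<Longrightarrow> (\<rho> has_vector_derivative lindblad (h t) m L (\<rho> t)) (at t)"
    and herm: "\<And>t. dagger (h t) = h t"
    and init: "\<And>x. x \<bullet> (\<rho> a *v x) = 0" and t: "t \<in> {a..b}"
  shows "x \<bullet> (\<rho> t *v x) = 0"
proof (rule antisym)
  let ?\<sigma> = "\<lambda>t. - \<rho> t"
  have neg: "- M = cscale (- 1) M" for M :: "complex^'n^'n"
    by (simp add: cscale_def vec_eq_iff)
  have "0 \<le> x \<bullet> (?\<sigma> t *v x)"
  proof (rule lindblad_positive[OF S])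
    show "continuous_on {a..b} ?\<sigma>" using cont by (rule continuous_on_minus)
    show "(?\<sigma> has_vector_derivative lindblad (h t) m L (?\<sigma> t)) (at t)" if "t \<in> {a<..<b} - S" for t
      using has_vector_derivative_minus[OF deriv[OF that]] by (simp only: neg lindblad_cscale)
    show "0 \<le> x \<bullet> (?\<sigma> a *v x)" for x
      using init[of x] by (simp add: neg cscale_mult_vec)
  qed (use herm t in auto)
  then show "x \<bullet> (\<rho> t *v x) \<le> 0"
    by (simp add: neg cscale_mult_vec)
  show "0 \<le> x \<bullet> (\<rho> t *v x)"
    by (rule lindblad_positive[OF S cont deriv herm _ t]) (simp_all add: init)
qed

text \<open>The form of \<open>\<i> M\<close> is minus the imaginary part of the Hermitian form of
  \<open>M\<close>. For the converse, polarization makes \<open>\<i> M\<close> skew-adjoint.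
  Hermiticity thus becomes a condition that positivity of the flow can transport.\<close>

lemma hermitian_iff_isotropic:
  fixes M :: "complex^'n^'n"
  shows "dagger M = M \<longleftrightarrow> (\<forall>x. x \<bullet> (cscale \<i> M *v x) = 0)"
proof
  assume "dagger M = M"
  then have "x \<bullet> (cscale \<i> M *v x) = - (x \<bullet> (cscale \<i> M *v x))" for x
  proof -
    have "x \<bullet> (cscale \<i> M *v x) = (M *v x) \<bullet> (\<i> *s x)"
      by (simp add: matrix_vector_inner_adjoint \<open>dagger M = M\<close> cscale_mult_vec mult_vec_cscale)
    also have "\<dots> = - (x \<bullet> (cscale \<i> M *v x))"
      by (simp add: cscale_mult_vec inner_vec_def inner_complex_def sum_negf[symmetric] algebra_simps)
    finally show ?thesis .
  qed
  then show "\<forall>x. x \<bullet> (cscale \<i> M *v x) = 0" by (simp add: equal_neg_zero)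
next
  define N where "N = cscale \<i> M"
  assume "\<forall>x. x \<bullet> (cscale \<i> M *v x) = 0"
  then have iso: "x \<bullet> (N *v x) = 0" for x by (simp add: N_def)
  have "(dagger N *v x + N *v x) \<bullet> y = 0" for x y
  proof -
    have "y \<bullet> (N *v x) + x \<bullet> (N *v y) = 0"
      using iso[of "x + y"]
      by (simp add: iso matrix_vector_right_distrib inner_add_left inner_add_right)
    then show ?thesis
      by (simp add: inner_add_left matrix_vector_inner_adjoint[of "dagger N"] inner_commute[of "N *v x"])
  qed
  then have "dagger N *v x + N *v x = 0" for x
    by (metis inner_eq_zero_iff)
  then have "dagger N + N = 0"
    unfolding matrix_eq[of _ 0] matrix_vector_mult_add_rdistrib matrix_vector_mult_0 by (rule allI)
  then have "(dagger N + N) $ i $ j = 0" for i j by (simp only: zero_index)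
  then have "cnj (\<i> * M $ j $ i) + \<i> * M $ i $ j = 0" for i j
    by (simp only: N_def dagger_def cscale_def vector_add_component vec_lambda_beta)
  then have "cnj (M $ j $ i) = M $ i $ j" for i j
    by (simp add: complex_eq_iff)
  then show "dagger M = M"
    by (simp only: dagger_def vec_eq_iff vec_lambda_beta) simp
qed

text \<open>\<open>\<i> \<rho>\<close> solves the same equation, and \<open>\<rho>\<close> is Hermitian iff the form of \<open>\<i> \<rho>\<close> vanishes.\<close>

lemma lindblad_hermitian:
  fixes \<rho> :: "real \<Rightarrow> complex^'n^'n"
  assumes S: "finite S" and cont: "continuous_on {a..b} \<rho>"
    and deriv: "\<And>t. t \<in> {a<..<b} - S \<Longrightarrow> (\<rho> has_vector_derivative lindblad (h t) m L (\<rho> t)) (at t)"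
    and herm: "\<And>t. dagger (h t) = h t"
    and init: "dagger (\<rho> a) = \<rho> a" and t: "t \<in> {a..b}"
  shows "dagger (\<rho> t) = \<rho> t"
proof -
  have lin: "bounded_linear (\<lambda>M :: complex^'n^'n. cscale \<i> M)"
    by (rule linear_conv_bounded_linear[THEN iffD1], rule linearI)
      (simp_all add: cscale_add cscale_scaleR)
  have "x \<bullet> (cscale \<i> (\<rho> t) *v x) = 0" for x
  proof (rule lindblad_isotropic[OF S _ _ herm _ t])
    show "continuous_on {a..b} (\<lambda>t. cscale \<i> (\<rho> t))"
      by (rule bounded_linear.continuous_on[OF lin cont])
    show "((\<lambda>t. cscale \<i> (\<rho> t)) has_vector_derivative lindblad (h t) m L (cscale \<i> (\<rho> t))) (at t)"
      if "t \<in> {a<..<b} - S" for t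
      using bounded_linear.has_vector_derivative[OF lin deriv[OF that]] by (simp add: lindblad_cscale)
    show "x \<bullet> (cscale \<i> (\<rho> a) *v x) = 0" for x
      using init by (simp add: hermitian_iff_isotropic)
  qed
  then show ?thesis by (simp add: hermitian_iff_isotropic)
qed

section \<open>Preservation of the trace\<close>

lemma trace_sum: "trace (\<Sum>k\<in>I. M k) = (\<Sum>k\<in>I. trace (M k :: complex^'n^'n))"
  by (induction I rule: infinite_finite_induct) (simp_all add: trace_add trace_def[of 0])

lemma trace_scaleR: "trace (r *\<^sub>R M) = r *\<^sub>R trace (M :: complex^'n^'n)"
  by (simp add: trace_def scaleR_sum_right)

lemma trace_cscale: "trace (cscale c M) = c * trace M"
  by (simp add: trace_def cscale_def sum_distrib_left)

lemma trace_dissipator: "trace (dissipator m L M) = 0"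
proof -
  have "trace (M ** dagger (L k) ** L k) = trace (dagger (L k) ** L k ** M)"
    "trace (L k ** M ** dagger (L k)) = trace (dagger (L k) ** L k ** M)" for k
    by (simp_all only: matrix_mul_assoc[symmetric] trace_mul_sym[of M] trace_mul_sym[of "L k"])
  then show ?thesis
    by (simp add: dissipator_def trace_sum trace_sub trace_scaleR flip: scaleR_add_left)
qed

lemma trace_lindblad: "trace (lindblad h m L M) = 0"
  by (simp add: lindblad_def trace_add trace_dissipator trace_cscale commutator_def trace_sub
      trace_mul_sym[of h])

section \<open>States with a pure marginal\<close>

text \<open>Testing the null vector x against M x in \<open>psd_isotropic_vector\<close> yields
  twice the squared norm of M x.\<close>

lemma psd_isotropic_kernel:
  fixes M :: "complex^'n^'n"
  assumes "dagger M = M" and "\<And>z. 0 \<le> z \<bullet> (M *v z)" and "x \<bullet> (M *v x) = 0"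
  shows "M *v x = 0"
proof -
  have "x \<bullet> (M *v (M *v x)) + (M *v x) \<bullet> (M *v x) = 0"
    by (rule psd_isotropic_vector[OF assms(2,3)])
  moreover have "x \<bullet> (M *v (M *v x)) = (M *v x) \<bullet> (M *v x)"
    by (simp add: matrix_vector_inner_adjoint[of M x] assms(1))
  ultimately show ?thesis by simp
qed

lemma sum_UNIV_prod: "(\<Sum>p\<in>UNIV. f p) = (\<Sum>i\<in>UNIV. \<Sum>j\<in>UNIV. f (i, j))"
  by (simp add: sum.cartesian_product flip: UNIV_Times_UNIV)

definition ptrace_B :: "two_qubit_mat \<Rightarrow> qubit_mat" where
  "ptrace_B \<rho> = (\<chi> i i'. \<Sum>k\<in>UNIV. \<rho> $ (i, k) $ (i', k))"

text \<open>Trace one and purity one force the marginal \<beta> to have determinant zero. If \<beta>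
  w = 0, the forms of \<rho> at the two vectors \<open>e i w\<close> are nonnegative with sum zero,
  so both vectors lie in the kernel of \<rho>. The resulting relations between entries of \<rho>
  give the product form.\<close>

lemma pure_marginal_imp_product:
  fixes \<rho> :: two_qubit_mat
  assumes herm: "dagger \<rho> = \<rho>" and psd: "\<And>x. 0 \<le> x \<bullet> (\<rho> *v x)"
    and tr: "trace \<rho> = 1" and pure: "trace (ptrace_A \<rho> ** ptrace_A \<rho>) = 1"
  shows "\<rho> = kron (ptrace_B \<rho>) (ptrace_A \<rho>)"
proof -
  let ?\<beta> = "ptrace_A \<rho>"
  define p q r s where "p = ?\<beta> $ 1 $ 1" and "q = ?\<beta> $ 1 $ 2" and "r = ?\<beta> $ 2 $ 1" and "s = ?\<beta> $ 2 $ 2"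
  have ps: "p + s = 1"
    using tr by (simp add: p_def s_def ptrace_A_def trace_def sum_UNIV_prod sum_2 algebra_simps)
  have "p * p + q * r + (r * q + s * s) = 1"
    using pure by (simp add: p_def q_def r_def s_def trace_def matrix_matrix_mult_def sum_2)
  moreover have "(p + s) * (p + s) = 1" using ps by simp
  ultimately have "2 * (q * r) = 2 * (p * s)" by algebra
  then have qr: "q * r = p * s" by (simp only: mult_cancel_left) simp
  have cnj\<rho>: "cnj (\<rho> $ x $ y) = \<rho> $ y $ x" for x y
    using arg_cong[OF herm, of "\<lambda>M. M $ y $ x"] by (simp add: dagger_def)
  have cnjs: "cnj p = p" "cnj s = s" "cnj q = r" "cnj r = q"
    by (simp_all add: p_def q_def r_def s_def ptrace_A_def cnj\<rho>)
  define e where "e = (\<lambda>i (w :: complex^2). (\<chi> x. if fst x = i then w $ snd x else 0) :: complex^(2\<times>2))"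
  have exhaust: "i = 1 \<or> i = 2" for i :: 2 by (rule exhaust_2)
  have ker: "\<rho> $ x $ (i, 1) * w $ 1 + \<rho> $ x $ (i, 2) * w $ 2 = 0"
    if w: "?\<beta> *v w = 0" for w i x
  proof -
    \<comment> \<open>\<open>e i w\<close> is \<open>e\<^sub>i \<otimes> w\<close>\<close>
    have "e 1 w \<bullet> (\<rho> *v e 1 w) + e 2 w \<bullet> (\<rho> *v e 2 w) = w \<bullet> (?\<beta> *v w)"
      by (simp add: e_def inner_vec_def matrix_vector_mult_def sum_UNIV_prod sum_2 ptrace_A_def
          inner_add_right algebra_simps)
    then have "e i w \<bullet> (\<rho> *v e i w) = 0"
      using psd[of "e 1 w"] psd[of "e 2 w"] w exhaust[of i] by auto
    then have "\<rho> *v e i w = 0" by (rule psd_isotropic_kernel[OF herm psd])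
    then have "(\<rho> *v e i w) $ x = 0" by simp
    then show ?thesis
      using exhaust[of i]
      by (auto simp: e_def matrix_vector_mult_def sum_UNIV_prod sum_2)
  qed
  \<comment> \<open>These are the columns of the adjugate of \<beta>; both are taken because one of
    them may vanish.\<close>
  have "?\<beta> *v (vector [s, - r]) = 0" "?\<beta> *v (vector [- q, p]) = 0"
    using qr by (simp_all add: vec_eq_iff forall_2 matrix_vector_mult_def sum_2
        p_def q_def r_def s_def mult.commute)
  from this[THEN ker] have
    k1: "\<rho> $ x $ (i, 1) * s = \<rho> $ x $ (i, 2) * r" and
    k2: "\<rho> $ x $ (i, 2) * p = \<rho> $ x $ (i, 1) * q" for x i
    by (simp_all add: add_eq_0_iff)
  have k3: "\<rho> $ (i, 1) $ x * s = \<rho> $ (i, 2) $ x * q" and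
    k4: "\<rho> $ (i, 2) $ x * p = \<rho> $ (i, 1) $ x * r" for x i
    using arg_cong[OF k1[of x i], of cnj] arg_cong[OF k2[of x i], of cnj]
    by (simp_all add: cnj\<rho> cnjs)
  \<comment> \<open>Splitting by p + s = 1 replaces division by p or s, either of which may be
    zero.\<close>
  have split: "z = z * p + z * s" for z using ps by (simp flip: distrib_left)
  have entry: "\<rho> $ (i, k) $ (j, k') = (\<rho> $ (i, 1) $ (j, 1) + \<rho> $ (i, 2) $ (j, 2)) * ?\<beta> $ k $ k'" for i j k k'
  proof -
    have "\<rho> $ (i, 1) $ (j, 1) = (\<rho> $ (i, 1) $ (j, 1) + \<rho> $ (i, 2) $ (j, 2)) * p"
      using split[of "\<rho> $ (i, 1) $ (j, 1)"] by (simp add: k1 k4 distrib_right)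
    moreover have "\<rho> $ (i, 1) $ (j, 2) = (\<rho> $ (i, 1) $ (j, 1) + \<rho> $ (i, 2) $ (j, 2)) * q"
      using split[of "\<rho> $ (i, 1) $ (j, 2)"] by (simp add: k2 k3 distrib_right)
    moreover have "\<rho> $ (i, 2) $ (j, 1) = (\<rho> $ (i, 1) $ (j, 1) + \<rho> $ (i, 2) $ (j, 2)) * r"
      using split[of "\<rho> $ (i, 2) $ (j, 1)"] by (simp add: k1 k4 distrib_right)
    moreover have "\<rho> $ (i, 2) $ (j, 2) = (\<rho> $ (i, 1) $ (j, 1) + \<rho> $ (i, 2) $ (j, 2)) * s"
      using split[of "\<rho> $ (i, 2) $ (j, 2)"] k1[of "(i, 1)" j] by (simp add: k4 distrib_right)
    ultimately show ?thesis
      using exhaust[of k] exhaust[of k'] by (auto simp: p_def q_def r_def s_def)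
  qed
  show ?thesis
    unfolding vec_eq_iff split_paired_All kron_def ptrace_B_def sum_2 vec_lambda_beta fst_conv snd_conv
    by (intro allI entry)
qed

section \<open>Two-qubit algebra\<close>

lemma kron_mult: "kron A B ** kron C D = kron (A ** C) (B ** D)"
  by (simp add: kron_def matrix_matrix_mult_def vec_eq_iff sum_UNIV_prod sum_product mult_ac)

lemma trace_kron: "trace (kron A B) = trace A * trace B"
  by (simp add: kron_def trace_def sum_UNIV_prod sum_product)

lemma dagger_kron: "dagger (kron A B) = kron (dagger A) (dagger B)"
  by (simp add: kron_def dagger_def vec_eq_iff)

lemma kron_add_left: "kron (A + B) C = kron A C + kron B C"
  by (simp add: kron_def vec_eq_iff algebra_simps)

lemma kron_diff_left: "kron (A - B) C = kron A C - kron B C"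
  by (simp add: kron_def vec_eq_iff algebra_simps)

lemma kron_diff_right: "kron C (A - B) = kron C A - kron C B"
  by (simp add: kron_def vec_eq_iff algebra_simps)

lemma kron_scaleR_left: "kron (r *\<^sub>R A) B = r *\<^sub>R kron A B"
  by (simp add: kron_def vec_eq_iff)

lemma kron_sum_left: "kron (\<Sum>k\<in>I. A k) B = (\<Sum>k\<in>I. kron (A k) B)"
  by (simp add: kron_def vec_eq_iff sum_distrib_right)

lemma dagger_mat_1: "dagger (mat 1) = mat 1"
  by (simp add: dagger_def mat_def vec_eq_iff)

lemma dagger_add: "dagger (A + B) = dagger A + dagger B"
  by (simp add: dagger_def vec_eq_iff)

lemma dagger_scaleR: "dagger (r *\<^sub>R A) = r *\<^sub>R dagger A"
  by (simp add: dagger_def vec_eq_iff)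

lemma dagger_sum: "dagger (\<Sum>k\<in>I. A k) = (\<Sum>k\<in>I. dagger (A k))"
  by (simp add: dagger_def vec_eq_iff)

lemma dissipator_kron:
  "dissipator m (\<lambda>k. kron (l k) (mat 1)) (kron \<alpha> \<beta>) = kron (dissipator m l \<alpha>) \<beta>"
  by (simp add: dissipator_def kron_sum_left kron_diff_left kron_scaleR_left kron_mult
      dagger_kron dagger_mat_1)

section \<open>Pauli matrices and Bloch coordinates\<close>

lemma pauli_entries:
  "pauli 1 $ 1 $ 1 = 0" "pauli 1 $ 1 $ 2 = 1" "pauli 1 $ 2 $ 1 = 1" "pauli 1 $ 2 $ 2 = 0"
  "pauli 2 $ 1 $ 1 = 0" "pauli 2 $ 1 $ 2 = - \<i>" "pauli 2 $ 2 $ 1 = \<i>" "pauli 2 $ 2 $ 2 = 0"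
  "pauli 3 $ 1 $ 1 = 1" "pauli 3 $ 1 $ 2 = 0" "pauli 3 $ 2 $ 1 = 0" "pauli 3 $ 2 $ 2 = - 1"
  by (simp_all add: pauli_def)

lemma dagger_pauli: "dagger (pauli j) = pauli j"
  using exhaust_3[of j] by (auto simp: dagger_def vec_eq_iff forall_2 pauli_entries)

lemma dagger_hamiltonian:
  "dagger HI = HI \<Longrightarrow> dagger (hamiltonian \<omega>a \<omega>b HI u) = hamiltonian \<omega>a \<omega>b HI u"
  by (simp add: hamiltonian_def dagger_add dagger_scaleR dagger_kron dagger_pauli dagger_sum
      dagger_mat_1)

lemma qubit_trace_simps:
  fixes A B :: qubit_mat
  shows "trace A = A $ 1 $ 1 + A $ 2 $ 2"
    and "(A ** B) $ i $ j = A $ i $ 1 * B $ 1 $ j + A $ i $ 2 * B $ 2 $ j"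
  by (simp_all add: trace_def matrix_matrix_mult_def sum_2)

text \<open>Twice the coordinates of the statement, so that pure states of trace one lie on the unit
  sphere.\<close>

definition bloch :: "qubit_mat \<Rightarrow> 3 \<Rightarrow> complex" where
  "bloch \<alpha> i = trace (\<alpha> ** pauli i)"

lemma bloch_simps:
  "bloch \<alpha> 1 = \<alpha> $ 1 $ 2 + \<alpha> $ 2 $ 1"
  "bloch \<alpha> 2 = \<i> * (\<alpha> $ 1 $ 2 - \<alpha> $ 2 $ 1)"
  "bloch \<alpha> 3 = \<alpha> $ 1 $ 1 - \<alpha> $ 2 $ 2"
  by (simp_all add: bloch_def qubit_trace_simps pauli_entries algebra_simps)

text \<open>The Pauli commutation relations: a commutator with a Pauli matrix rotates the Bloch
  vector about the corresponding axis.\<close>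

lemma bloch_commutator:
  "trace (commutator (pauli 1) \<alpha> ** pauli 1) = 0"
  "trace (commutator (pauli 1) \<alpha> ** pauli 2) = - 2 * \<i> * bloch \<alpha> 3"
  "trace (commutator (pauli 1) \<alpha> ** pauli 3) = 2 * \<i> * bloch \<alpha> 2"
  "trace (commutator (pauli 2) \<alpha> ** pauli 1) = 2 * \<i> * bloch \<alpha> 3"
  "trace (commutator (pauli 2) \<alpha> ** pauli 2) = 0"
  "trace (commutator (pauli 2) \<alpha> ** pauli 3) = - 2 * \<i> * bloch \<alpha> 1"
  "trace (commutator (pauli 3) \<alpha> ** pauli 1) = - 2 * \<i> * bloch \<alpha> 2"
  "trace (commutator (pauli 3) \<alpha> ** pauli 2) = 2 * \<i> * bloch \<alpha> 1"
  "trace (commutator (pauli 3) \<alpha> ** pauli 3) = 0"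
  by (simp_all add: bloch_simps commutator_def qubit_trace_simps pauli_entries algebra_simps)

text \<open>Pairing of \<open>[\<sigma>\<^sub>3 \<otimes> \<sigma>\<^sub>1, \<alpha> \<otimes> \<beta>]\<close> with \<open>P \<otimes> Q\<close>.\<close>

definition exchange :: "qubit_mat \<Rightarrow> qubit_mat \<Rightarrow> qubit_mat \<Rightarrow> qubit_mat \<Rightarrow> complex" where
  "exchange \<alpha> \<beta> P Q = trace (pauli 3 ** \<alpha> ** P) * trace (pauli 1 ** \<beta> ** Q)
     - trace (\<alpha> ** pauli 3 ** P) * trace (\<beta> ** pauli 1 ** Q)"

definition local_hamiltonian :: "real \<Rightarrow> real^3 \<Rightarrow> qubit_mat" where
  "local_hamiltonian \<omega>a u = (1/2) *\<^sub>R (\<omega>a *\<^sub>R pauli 3 + (\<Sum>j\<in>UNIV. u $ j *\<^sub>R pauli j))"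

text \<open>The control enters only through the local generator of A. For \<open>P = mat 1\<close>
  that term is a vanishing trace, which is why the motion of qubit B does not involve the
  control.\<close>

lemma trace_master_rhs_kron:
  "trace (master_rhs \<omega>a \<omega>b ((g / 2) *\<^sub>R kron (pauli 3) (pauli 1)) m l u (kron \<alpha> \<beta>) ** kron P Q)
    = trace (lindblad (local_hamiltonian \<omega>a u) m l \<alpha> ** P) * trace (\<beta> ** Q)
      - \<i> * (g / 2) * exchange \<alpha> \<beta> P Q
      - \<i> * (\<omega>b / 2) * trace (\<alpha> ** P) * trace (commutator (pauli 3) \<beta> ** Q)"
proof -
  have diff: "(A - B) ** C = A ** C - B ** C" for A B C :: "complex^'n^'n"
    by (simp add: matrix_matrix_mult_def vec_eq_iff sum_subtractf algebra_simps)
  have sc: "(r *\<^sub>R A) ** B = r *\<^sub>R (A ** B)" "A ** (r *\<^sub>R B) = r *\<^sub>R (A ** B)" for r and A B :: "complex^'n^'n"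
    by (simp_all add: scalar_matrix_assoc matrix_scalar_ac)
  have kr: "kron A (r *\<^sub>R B) = r *\<^sub>R kron A B" for r A B
    by (simp add: kron_def vec_eq_iff)
  have "master_rhs \<omega>a \<omega>b ((g / 2) *\<^sub>R kron (pauli 3) (pauli 1)) m l u (kron \<alpha> \<beta>)
    = kron (lindblad (local_hamiltonian \<omega>a u) m l \<alpha>) \<beta>
      + cscale (- \<i>) ((g / 2) *\<^sub>R (kron (pauli 3 ** \<alpha>) (pauli 1 ** \<beta>) - kron (\<alpha> ** pauli 3) (\<beta> ** pauli 1))
      + (\<omega>b / 2) *\<^sub>R kron \<alpha> (commutator (pauli 3) \<beta>))"
    unfolding master_rhs_def hamiltonian_def local_hamiltonian_def[symmetric] dissipator_kron lindblad_def
    by (simp add: commutator_def mult_add_left matrix_add_ldistrib sc kron_mult kron_add_left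
        kron_diff_left kron_diff_right cscale_add cscale_diff cscale_scaleR kr algebra_simps)
      (simp add: kron_def cscale_def vec_eq_iff algebra_simps)
  then show ?thesis
    by (simp add: mult_add_left cscale_mult diff sc kron_mult trace_add trace_sub trace_cscale
        trace_scaleR trace_kron exchange_def scaleR_conv_of_real[where 'a = complex] algebra_simps)
qed

lemma exchange_simps:
  "exchange \<alpha> \<beta> (pauli 1) (pauli 1) = - 2 * \<i> * bloch \<alpha> 2 * trace \<beta>"
  "exchange \<alpha> \<beta> (pauli 2) (pauli 1) = 2 * \<i> * bloch \<alpha> 1 * trace \<beta>"
  "exchange \<alpha> \<beta> (pauli 3) (pauli 2) = - 2 * \<i> * trace \<alpha> * bloch \<beta> 3"
  "exchange \<alpha> \<beta> (pauli 3) (pauli 3) = 2 * \<i> * trace \<alpha> * bloch \<beta> 2"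
  "exchange \<alpha> \<beta> (pauli 1) (mat 1) = - 2 * \<i> * bloch \<alpha> 2 * bloch \<beta> 1"
  "exchange \<alpha> \<beta> (pauli 2) (mat 1) = 2 * \<i> * bloch \<alpha> 1 * bloch \<beta> 1"
  "exchange \<alpha> \<beta> (pauli 3) (mat 1) = 0"
  "exchange \<alpha> \<beta> (mat 1) (pauli 1) = 0"
  "exchange \<alpha> \<beta> (mat 1) (pauli 2) = - 2 * \<i> * bloch \<alpha> 3 * bloch \<beta> 3"
  "exchange \<alpha> \<beta> (mat 1) (pauli 3) = 2 * \<i> * bloch \<alpha> 3 * bloch \<beta> 2"
  by (simp_all add: bloch_simps exchange_def qubit_trace_simps pauli_entries algebra_simps)

lemma purity_bloch:
  "2 * trace (\<beta> ** \<beta>) = (trace \<beta>)\<^sup>2 + (bloch \<beta> 1)\<^sup>2 + (bloch \<beta> 2)\<^sup>2 + (bloch \<beta> 3)\<^sup>2"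
  unfolding bloch_simps qubit_trace_simps by (simp add: power_mult_distrib) algebra

text \<open>The hypothesis \<open>cond\<close> is the Leibniz rule for products of Bloch
  coordinates, restricted to the interaction. Its pairs (1,1) and (2,1) give the two transverse
  coordinates of \<alpha>; the pairs (3,2) and (3,3) give the third, since purity leaves
  \<open>bloch \<beta> 2\<close> or \<open>bloch \<beta> 3\<close> nonzero.\<close>

lemma product_preserving_imp_pole:
  assumes tr: "trace \<alpha> = 1" "trace \<beta> = 1" "trace (\<beta> ** \<beta>) = 1"
    and y1: "(bloch \<beta> 1)\<^sup>2 \<noteq> 1"
    and cond: "\<And>i j. exchange \<alpha> \<beta> (pauli i) (pauli j)
      = exchange \<alpha> \<beta> (pauli i) (mat 1) * bloch \<beta> j + bloch \<alpha> i * exchange \<alpha> \<beta> (mat 1) (pauli j)"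
  shows "bloch \<alpha> 1 = 0 \<and> bloch \<alpha> 2 = 0 \<and> (bloch \<alpha> 3)\<^sup>2 = 1"
proof -
  have nz: "1 - (bloch \<beta> 1)\<^sup>2 \<noteq> 0" using y1 by simp
  have "2 * \<i> * (bloch \<alpha> 2 * (1 - (bloch \<beta> 1)\<^sup>2)) = 0"
    using cond[of 1 1] unfolding exchange_simps tr by algebra
  then have x2: "bloch \<alpha> 2 = 0" using nz by simp
  have "2 * \<i> * (bloch \<alpha> 1 * (1 - (bloch \<beta> 1)\<^sup>2)) = 0"
    using cond[of 2 1] unfolding exchange_simps tr by algebra
  then have x1: "bloch \<alpha> 1 = 0" using nz by simp
  have "2 * \<i> * (bloch \<beta> 3 * (1 - (bloch \<alpha> 3)\<^sup>2)) = 0"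
    using cond[of 3 2] unfolding exchange_simps tr by algebra
  then have y3: "bloch \<beta> 3 = 0 \<or> (bloch \<alpha> 3)\<^sup>2 = 1" by auto
  have "2 * \<i> * (bloch \<beta> 2 * (1 - (bloch \<alpha> 3)\<^sup>2)) = 0"
    using cond[of 3 3] unfolding exchange_simps tr by algebra
  then have y2: "bloch \<beta> 2 = 0 \<or> (bloch \<alpha> 3)\<^sup>2 = 1" by auto
  have "(bloch \<beta> 1)\<^sup>2 + (bloch \<beta> 2)\<^sup>2 + (bloch \<beta> 3)\<^sup>2 = 1"
    using purity_bloch[of \<beta>] unfolding tr by (simp add: add.assoc)
  with y1 y2 y3 x1 x2 show ?thesis by auto
qed

lemma bloch_expansion:
  "\<alpha> = (1/2) *\<^sub>R (cscale (trace \<alpha>) (mat 1) + cscale (bloch \<alpha> 1) (pauli 1)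
     + cscale (bloch \<alpha> 2) (pauli 2) + cscale (bloch \<alpha> 3) (pauli 3))"
  unfolding vec_eq_iff forall_2
  by (simp add: cscale_def bloch_simps qubit_trace_simps pauli_entries mat_def
      scaleR_conv_of_real[where 'a = complex] field_simps)

text \<open>At a pole \<alpha> is (I + x3 \<sigma>3)/2, with x3 its third Bloch coordinate, so
  linearity of the dissipator leaves \<open>v0\<close> and the third column of \<open>d_hat\<close>.
  Rotation about the third axis fixes a pole, hence \<open>\<omega>a\<close> and the third control
  component drop out.\<close>

lemma trace_lindblad_pole:
  assumes "trace \<alpha> = 1" "bloch \<alpha> 1 = 0" "bloch \<alpha> 2 = 0"
  shows "trace (lindblad (local_hamiltonian \<omega>a u) m l \<alpha> ** pauli 1)
      = v0 m l 1 + bloch \<alpha> 3 * d_hat m l 1 3 + of_real (u $ 2) * bloch \<alpha> 3" (is ?t1)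
    and "trace (lindblad (local_hamiltonian \<omega>a u) m l \<alpha> ** pauli 2)
      = v0 m l 2 + bloch \<alpha> 3 * d_hat m l 2 3 - of_real (u $ 1) * bloch \<alpha> 3" (is ?t2)
    and "trace (lindblad (local_hamiltonian \<omega>a u) m l \<alpha> ** pauli 3)
      = v0 m l 3 + bloch \<alpha> 3 * d_hat m l 3 3" (is ?t3)
proof -
  have "\<alpha> = cscale (1/2) (mat 1 + cscale (bloch \<alpha> 3) (pauli 3))"
    using assms by (subst bloch_expansion[of \<alpha>])
      (simp add: cscale_def vec_eq_iff scaleR_conv_of_real[where 'a = complex])
  then have "dissipator m l \<alpha> = dissipator m l (cscale (1/2) (mat 1 + cscale (bloch \<alpha> 3) (pauli 3)))"
    by (rule arg_cong)
  then have D: "trace (dissipator m l \<alpha> ** pauli i) = v0 m l i + bloch \<alpha> 3 * d_hat m l i 3" for i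
    by (simp add: dissipator_add dissipator_cscale cscale_mult mult_add_left trace_add trace_cscale
        v0_def d_hat_def trace_mul_sym[of "pauli i"] cscale_add)
  have K: "commutator (local_hamiltonian \<omega>a u) \<alpha>
    = cscale (of_real (u $ 1) / 2) (commutator (pauli 1) \<alpha>)
      + cscale (of_real (u $ 2) / 2) (commutator (pauli 2) \<alpha>)
      + cscale (of_real (\<omega>a + u $ 3) / 2) (commutator (pauli 3) \<alpha>)"
    by (simp add: vec_eq_iff local_hamiltonian_def commutator_def cscale_def sum_3
        matrix_matrix_mult_def sum_2 scaleR_conv_of_real[where 'a = complex] field_simps)
  have H: "trace (cscale (- \<i>) (commutator (local_hamiltonian \<omega>a u) \<alpha>) ** pauli i)
    = - \<i> * (of_real (u $ 1) / 2 * trace (commutator (pauli 1) \<alpha> ** pauli i)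
      + of_real (u $ 2) / 2 * trace (commutator (pauli 2) \<alpha> ** pauli i)
      + of_real (\<omega>a + u $ 3) / 2 * trace (commutator (pauli 3) \<alpha> ** pauli i))" for i
    unfolding K cscale_mult trace_cscale mult_add_left trace_add ..
  show ?t1 ?t2 ?t3
    unfolding lindblad_def mult_add_left trace_add H D bloch_commutator assms
    by (simp_all add: algebra_simps)
qed

section \<open>Calculus with finitely many exceptional points\<close>

lemma has_vector_derivative_unique_on_interval:
  assumes "(f has_vector_derivative D) (at t)" "(h has_vector_derivative E) (at t)"
    and "t \<in> {a<..<b}" "\<And>s. s \<in> {a<..<b} \<Longrightarrow> f s = h s"
  shows "D = E"
proof -
  have "(h has_vector_derivative D) (at t)"
    by (rule has_vector_derivative_transform_within_open[OF assms(1) _ assms(3,4)]) simp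
  then show ?thesis using assms(2) by (rule vector_derivative_unique_at)
qed

text \<open>The fundamental theorem of calculus tolerates finitely many exceptions and makes f an
  integral of G; continuity of G then gives the derivative at the exceptional times and, one-sided,
  at the endpoints.\<close>

lemma has_vector_derivative_finite_exceptions:
  fixes f :: "real \<Rightarrow> 'a::banach"
  assumes "finite S" and f: "continuous_on {a..b} f" and G: "continuous_on {a..b} G"
    and deriv: "\<And>t. t \<in> {a<..<b} - S \<Longrightarrow> (f has_vector_derivative G t) (at t)"
    and t: "t \<in> {a..b}"
  shows "(f has_vector_derivative G t) (at t within {a..b})"
proof -
  have eq: "f x = f a + integral {a..x} G" if x: "x \<in> {a..b}" for x
  proof -
    have "(G has_integral (f x - f a)) {a..x}"
    proof (rule fundamental_theorem_of_calculus_interior_strong[OF \<open>finite S\<close>])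
      show "continuous_on {a..x} f"
        by (rule continuous_on_subset[OF f]) (use x in auto)
    qed (use x deriv in auto)
    then show ?thesis by (simp add: integral_unique)
  qed
  have "((\<lambda>x. f a + integral {a..x} G) has_vector_derivative G t) (at t within {a..b})"
    using has_vector_derivative_add[OF has_vector_derivative_const integral_has_vector_derivative[OF G t]]
    by (simp only: add_0)
  then show ?thesis
    by (rule has_vector_derivative_transform[OF t, rotated]) (rule eq)
qed

lemma subinterval_avoiding_finite:
  fixes a b e t :: real
  assumes "a < b" "t \<in> {a..b}" "e > 0" "finite S"
  obtains c d where "c < d" "{c<..<d} \<subseteq> {a<..<b} - S" "{c<..<d} \<subseteq> ball t e"
proof -
  let ?I = "{max a (t - e)<..<min b (t + e)}"
  have ne: "max a (t - e) < min b (t + e)" using assms by auto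
  then have "infinite ?I" by (simp add: infinite_Ioo)
  then have "?I - S \<noteq> {}" using \<open>finite S\<close> by (metis Diff_eq_empty_iff finite_subset)
  then obtain p where p: "p \<in> ?I - S" by blast
  moreover have "open (?I - S)" using \<open>finite S\<close> by (intro open_Diff finite_imp_closed) auto
  ultimately obtain r where r: "r > 0" "ball p r \<subseteq> ?I - S" by (meson open_contains_ball)
  have eq: "{p - r<..<p + r} = ball p r" by (auto simp: dist_real_def)
  show ?thesis
  proof
    show "p - r < p + r" using r by simp
    show "{p - r<..<p + r} \<subseteq> {a<..<b} - S" "{p - r<..<p + r} \<subseteq> ball t e"
      unfolding eq using r(2) by (force simp: dist_real_def)+
  qed
qed

text \<open>The level set is closed, and its complement, if nonempty, would contain an interval free
  of exceptional times. One point per interval is all that \<open>y1_not_stuck\<close> can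
  supply.\<close>

lemma eq_const_if_dense:
  fixes f :: "real \<Rightarrow> 'a::t1_space"
  assumes "a < b" "finite S" and f: "continuous_on {a..b} f"
    and dense: "\<And>c d. c < d \<Longrightarrow> {c<..<d} \<subseteq> {a<..<b} - S \<Longrightarrow> \<exists>s\<in>{c<..<d}. f s = v"
    and t: "t \<in> {a..b}"
  shows "f t = v"
proof (rule ccontr)
  assume "f t \<noteq> v"
  have "closed {s \<in> {a..b}. f s = v}"
    by (rule continuous_closed_preimage_constant[OF f]) simp
  then have "open (- {s \<in> {a..b}. f s = v})" by (rule open_Compl)
  moreover have "t \<in> - {s \<in> {a..b}. f s = v}" using \<open>f t \<noteq> v\<close> by simp
  ultimately obtain e where e: "e > 0" "ball t e \<subseteq> - {s \<in> {a..b}. f s = v}"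
    by (meson open_contains_ball)
  obtain c d where cd: "c < d" "{c<..<d} \<subseteq> {a<..<b} - S" "{c<..<d} \<subseteq> ball t e"
    using subinterval_avoiding_finite[OF \<open>a < b\<close> t \<open>e > 0\<close> \<open>finite S\<close>] .
  from dense[OF cd(1,2)] obtain s where s: "s \<in> {c<..<d}" "f s = v" by blast
  have "s \<in> - {s \<in> {a..b}. f s = v}" using s(1) cd(3) e(2) by blast
  moreover have "s \<in> {a..b}" using s(1) cd(2) by force
  ultimately show False using s(2) by simp
qed

text \<open>Meant for the control: continuity is assumed at the single time t, which may itself be
  an exceptional time of the solution.\<close>

lemma eq_const_at_continuity_point:
  fixes f :: "real \<Rightarrow> 'a::metric_space"
  assumes "a < b" "finite S" and f: "continuous (at t within {a..b}) f"
    and v: "\<And>s. s \<in> {a<..<b} - S \<Longrightarrow> f s = v"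
    and t: "t \<in> {a..b}"
  shows "f t = v"
proof (rule ccontr)
  assume "f t \<noteq> v"
  then have "dist v (f t) > 0" by simp
  with f obtain e where e: "e > 0"
    and close: "\<And>s. s \<in> {a..b} \<Longrightarrow> dist s t < e \<Longrightarrow> dist (f s) (f t) < dist v (f t)"
    unfolding continuous_within_eps_delta by blast
  obtain c d where cd: "c < d" "{c<..<d} \<subseteq> {a<..<b} - S" "{c<..<d} \<subseteq> ball t e"
    using subinterval_avoiding_finite[OF \<open>a < b\<close> t \<open>e > 0\<close> \<open>finite S\<close>] .
  define s where "s = (c + d) / 2"
  have s: "s \<in> {c<..<d}" using cd(1) by (simp add: s_def)
  then have "s \<in> {a<..<b} - S" "s \<in> ball t e" using cd by auto
  then show False using close[of s] v[of s] by (simp add: dist_commute)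
qed

section \<open>The solution with a pure marginal\<close>

lemma density_matrices_altdef:
  "\<rho> \<in> density_matrices \<longleftrightarrow> dagger \<rho> = \<rho> \<and> (\<forall>x. 0 \<le> x \<bullet> (\<rho> *v x)) \<and> trace \<rho> = 1"
proof -
  have entry: "z \<bullet> (a * b) = Re (cnj z * a * b)" for a b z :: complex
    by (simp add: inner_complex_def algebra_simps)
  have "Re (\<Sum>i\<in>UNIV. \<Sum>j\<in>UNIV. cnj (x $ i) * \<rho> $ i $ j * x $ j) = x \<bullet> (\<rho> *v x)" for x
    by (simp only: inner_vec_def matrix_vector_mult_def vec_lambda_beta inner_sum_right entry Re_sum)
  then show ?thesis by (simp add: density_matrices_def)
qed

lemma bounded_linear_trace_mult: "bounded_linear (\<lambda>M :: complex^'n^'n. trace (M ** N))"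
  by (rule linear_conv_bounded_linear[THEN iffD1], rule linearI)
    (simp_all add: mult_add_left trace_add trace_scaleR scalar_matrix_assoc[symmetric])

lemma trace_commutator: "trace (commutator A B) = 0"
  by (simp add: commutator_def trace_sub trace_mul_sym[of A])

text \<open>The exceptional set is fixed and the equation is kept as a two-sided derivative at
  interior times; endpoints are recovered by continuity.\<close>

locale pure_marginal_solution =
  fixes g \<omega>a \<omega>b \<epsilon> :: real
    and m :: nat and l :: "nat \<Rightarrow> complex^2^2"
    and u :: "real \<Rightarrow> real^3"
    and \<rho> :: "real \<Rightarrow> complex^(2 \<times> 2)^(2 \<times> 2)"
    and S :: "real set"
  assumes g: "g \<noteq> 0" and \<omega>b: "\<omega>b \<noteq> 0" and \<epsilon>: "0 < \<epsilon>"
    and finite_S: "finite S" and cont: "continuous_on {0..\<epsilon>} \<rho>"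
    and deriv: "t \<in> {0<..<\<epsilon>} - S \<Longrightarrow> (\<rho> has_vector_derivative
        master_rhs \<omega>a \<omega>b ((g / 2) *\<^sub>R kron (pauli 3) (pauli 1)) m l (u t) (\<rho> t)) (at t)"
    and init: "\<rho> 0 \<in> density_matrices"
    and pure: "t \<in> {0..\<epsilon>} \<Longrightarrow> trace (ptrace_A (\<rho> t) ** ptrace_A (\<rho> t)) = 1"
begin

abbreviation "\<alpha> t \<equiv> ptrace_B (\<rho> t)"
abbreviation "\<beta> t \<equiv> ptrace_A (\<rho> t)"

abbreviation "H t \<equiv> hamiltonian \<omega>a \<omega>b ((g / 2) *\<^sub>R kron (pauli 3) (pauli 1)) (u t)"

lemma deriv_lindblad: "t \<in> {0<..<\<epsilon>} - S \<Longrightarrow>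
    (\<rho> has_vector_derivative lindblad (H t) m (\<lambda>k. kron (l k) (mat 1)) (\<rho> t)) (at t)"
  using deriv[of t] by (simp only: master_rhs_def lindblad_def)

lemma dagger_H: "dagger (H t) = H t"
  by (intro dagger_hamiltonian) (simp add: dagger_scaleR dagger_kron dagger_pauli)

lemma hermitian: "t \<in> {0..\<epsilon>} \<Longrightarrow> dagger (\<rho> t) = \<rho> t"
  by (rule lindblad_hermitian[OF finite_S cont deriv_lindblad dagger_H])
    (use init in \<open>simp_all add: density_matrices_altdef\<close>)

lemma positive: "t \<in> {0..\<epsilon>} \<Longrightarrow> 0 \<le> x \<bullet> (\<rho> t *v x)"
  by (rule lindblad_positive[OF finite_S cont deriv_lindblad dagger_H])
    (use init in \<open>simp_all add: density_matrices_altdef\<close>)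

lemma trace_one: "t \<in> {0..\<epsilon>} \<Longrightarrow> trace (\<rho> t) = 1"
proof (rule has_derivative_zero_unique_strong_interval[where k = "insert 0 (insert \<epsilon> S)"])
  have bl: "bounded_linear (\<lambda>M :: two_qubit_mat. trace M)"
    using bounded_linear_trace_mult[where N = "mat 1 :: two_qubit_mat"] by simp
  show "continuous_on {0..\<epsilon>} (\<lambda>t. trace (\<rho> t))"
    by (rule bounded_linear.continuous_on[OF bl cont])
  show "((\<lambda>t. trace (\<rho> t)) has_derivative (\<lambda>h. 0)) (at s within {0..\<epsilon>})"
    if "s \<in> {0..\<epsilon>} - insert 0 (insert \<epsilon> S)" for s
  proof -
    have "s \<in> {0<..<\<epsilon>} - S" using that by auto
    from bounded_linear.has_vector_derivative[OF bl deriv_lindblad[OF this]]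
    have "((\<lambda>t. trace (\<rho> t)) has_vector_derivative 0) (at s)"
      by (simp only: trace_lindblad)
    then show ?thesis
      by (simp add: has_vector_derivative_def has_derivative_at_withinI)
  qed
qed (use init finite_S in \<open>simp_all add: density_matrices_altdef\<close>)

lemma product: "t \<in> {0..\<epsilon>} \<Longrightarrow> \<rho> t = kron (\<alpha> t) (\<beta> t)"
  by (intro pure_marginal_imp_product hermitian positive trace_one pure)

lemma trace_marginals:
  assumes "t \<in> {0..\<epsilon>}"
  shows "trace (\<alpha> t) = 1" "trace (\<beta> t) = 1"
  using trace_one[OF assms]
  by (simp_all add: trace_def ptrace_A_def ptrace_B_def sum_UNIV_prod sum_2 algebra_simps)

text \<open>Being linear in \<rho>, these expectations can be differentiated through the master
  equation, with no separate derivative of the factors \<alpha> and \<beta>.\<close>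

definition E where "E P Q t = trace (\<rho> t ** kron P Q)"

lemma E_product: "t \<in> {0..\<epsilon>} \<Longrightarrow> E P Q t = trace (\<alpha> t ** P) * trace (\<beta> t ** Q)"
  unfolding E_def by (subst product) (simp_all only: kron_mult trace_kron)

lemma E_continuous: "continuous_on {0..\<epsilon>} (E P Q)"
  unfolding E_def by (rule bounded_linear.continuous_on[OF bounded_linear_trace_mult cont])

lemma bloch_\<alpha>: "t \<in> {0..\<epsilon>} \<Longrightarrow> bloch (\<alpha> t) i = E (pauli i) (mat 1) t"
  by (simp add: E_product bloch_def trace_marginals)

lemma bloch_\<beta>: "t \<in> {0..\<epsilon>} \<Longrightarrow> bloch (\<beta> t) j = E (mat 1) (pauli j) t"
  by (simp add: E_product bloch_def trace_marginals)

lemma continuous_bloch_\<alpha>: "continuous_on {0..\<epsilon>} (\<lambda>t. bloch (\<alpha> t) i)"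
  using E_continuous[of "pauli i" "mat 1"]
  by (rule continuous_on_eq) (rule bloch_\<alpha>[symmetric])

abbreviation "L t \<equiv> lindblad (local_hamiltonian \<omega>a (u t)) m l (\<alpha> t)"

section \<open>Equations of motion for the expectations\<close>

lemma E_deriv:
  assumes t: "t \<in> {0<..<\<epsilon>} - S"
  shows "(E P Q has_vector_derivative
    trace (L t ** P) * trace (\<beta> t ** Q) - \<i> * (g / 2) * exchange (\<alpha> t) (\<beta> t) P Q
      - \<i> * (\<omega>b / 2) * trace (\<alpha> t ** P) * trace (commutator (pauli 3) (\<beta> t) ** Q)) (at t)"
proof -
  have p: "\<rho> t = kron (\<alpha> t) (\<beta> t)" using t by (intro product) simp
  have "((\<lambda>t. trace (\<rho> t ** kron P Q)) has_vector_derivative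
    trace (master_rhs \<omega>a \<omega>b ((g / 2) *\<^sub>R kron (pauli 3) (pauli 1)) m l (u t) (\<rho> t) ** kron P Q)) (at t)"
    by (rule bounded_linear.has_vector_derivative[OF bounded_linear_trace_mult deriv[OF t]])
  moreover have "trace (master_rhs \<omega>a \<omega>b ((g / 2) *\<^sub>R kron (pauli 3) (pauli 1)) m l (u t) (\<rho> t) ** kron P Q)
    = trace (master_rhs \<omega>a \<omega>b ((g / 2) *\<^sub>R kron (pauli 3) (pauli 1)) m l (u t) (kron (\<alpha> t) (\<beta> t)) ** kron P Q)"
    using arg_cong[OF p, of "\<lambda>M. trace (master_rhs \<omega>a \<omega>b ((g / 2) *\<^sub>R kron (pauli 3) (pauli 1)) m l (u t) M ** kron P Q)"] .
  ultimately show ?thesis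
    unfolding E_def[abs_def] by (simp only: trace_master_rhs_kron)
qed

lemma x_deriv:
  assumes t: "t \<in> {0<..<\<epsilon>} - S"
  shows "(E (pauli i) (mat 1) has_vector_derivative
    trace (L t ** pauli i) - \<i> * (g / 2) * exchange (\<alpha> t) (\<beta> t) (pauli i) (mat 1)) (at t)"
proof -
  have "trace (\<beta> t) = 1" using t by (intro trace_marginals) simp
  then show ?thesis
    using E_deriv[OF t, of "pauli i" "mat 1"] by (simp only: matrix_mul_rid trace_commutator) simp
qed

lemma y_deriv:
  assumes t: "t \<in> {0<..<\<epsilon>} - S"
  shows "(E (mat 1) (pauli j) has_vector_derivative
    - \<i> * (g / 2) * exchange (\<alpha> t) (\<beta> t) (mat 1) (pauli j)
      - \<i> * (\<omega>b / 2) * trace (commutator (pauli 3) (\<beta> t) ** pauli j)) (at t)"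
proof -
  have "trace (\<alpha> t) = 1" using t by (intro trace_marginals) simp
  then show ?thesis
    using E_deriv[OF t, of "mat 1" "pauli j"] by (simp only: matrix_mul_rid trace_lindblad) simp
qed

lemma y_deriv_components:
  assumes t: "t \<in> {0<..<\<epsilon>} - S"
  shows "(E (mat 1) (pauli 1) has_vector_derivative - \<omega>b * bloch (\<beta> t) 2) (at t)"
    "(E (mat 1) (pauli 2) has_vector_derivative
      \<omega>b * bloch (\<beta> t) 1 - g * bloch (\<alpha> t) 3 * bloch (\<beta> t) 3) (at t)"
    "(E (mat 1) (pauli 3) has_vector_derivative g * bloch (\<alpha> t) 3 * bloch (\<beta> t) 2) (at t)"
  using y_deriv[OF t, of 1] y_deriv[OF t, of 2] y_deriv[OF t, of 3]
  unfolding exchange_simps bloch_commutator by (simp_all add: field_simps)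

text \<open>In a product state the expectation of two Pauli matrices factors. Differentiating both
  sides, the local terms obey the Leibniz rule and cancel; the interaction terms remain, and the
  nonzero \<open>g\<close> is divided out.\<close>

lemma exchange_product:
  assumes t: "t \<in> {0<..<\<epsilon>} - S"
  shows "exchange (\<alpha> t) (\<beta> t) (pauli i) (pauli j)
    = exchange (\<alpha> t) (\<beta> t) (pauli i) (mat 1) * bloch (\<beta> t) j
      + bloch (\<alpha> t) i * exchange (\<alpha> t) (\<beta> t) (mat 1) (pauli j)"
proof -
  have t': "t \<in> {0<..<\<epsilon>}" "t \<in> {0..\<epsilon>}" using t by auto
  have eq: "E (pauli i) (pauli j) s = E (pauli i) (mat 1) s * E (mat 1) (pauli j) s" if "s \<in> {0<..<\<epsilon>}" for s
  proof -
    have "s \<in> {0..\<epsilon>}" using that by auto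
    then show ?thesis by (simp add: E_product trace_marginals)
  qed
  note D = has_vector_derivative_unique_on_interval[OF E_deriv[OF t]
      has_vector_derivative_mult[OF x_deriv[OF t] y_deriv[OF t]] t'(1) eq]
  have "8 * \<i> * complex_of_real g * (exchange (\<alpha> t) (\<beta> t) (pauli i) (pauli j)
    - exchange (\<alpha> t) (\<beta> t) (pauli i) (mat 1) * bloch (\<beta> t) j
      - bloch (\<alpha> t) i * exchange (\<alpha> t) (\<beta> t) (mat 1) (pauli j)) = 0"
    using D unfolding bloch_\<alpha>[OF t'(2), symmetric] bloch_\<beta>[OF t'(2), symmetric]
      bloch_def[symmetric] by (simp add: field_simps)
  then show ?thesis using g by (simp add: diff_diff_eq)
qed

text \<open>If the square stayed 1, its derivative would give y2 = 0 and purity y3 = 0; the second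
  equation of motion then reads \<open>\<omega>b * y1 = 0\<close>, which is impossible.\<close>

lemma y1_not_stuck:
  assumes "c < d" and cd: "{c<..<d} \<subseteq> {0<..<\<epsilon>} - S"
  shows "\<exists>t\<in>{c<..<d}. (bloch (\<beta> t) 1)\<^sup>2 \<noteq> 1"
proof (rule ccontr)
  assume "\<not> ?thesis"
  then have y1: "bloch (\<beta> t) 1 * bloch (\<beta> t) 1 = 1" if "t \<in> {c<..<d}" for t
    using that by (auto simp: power2_eq_square)
  have I: "t \<in> {0<..<\<epsilon>} - S" "t \<in> {0..\<epsilon>}" if "t \<in> {c<..<d}" for t
    using that cd by force+
  have y2: "bloch (\<beta> t) 2 = 0" if t: "t \<in> {c<..<d}" for t
  proof -
    note D = y_deriv_components(1)[OF I(1)[OF t]]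
    \<comment> \<open>Differentiating y1 y1 = 1 spares an argument that the sign of y1 is constant.
      Purity alone gives y2^2 + y3^2 = 0, which does not suffice for coordinates typed as
      complex.\<close>
    have "E (mat 1) (pauli 1) t * (- \<omega>b * bloch (\<beta> t) 2) + (- \<omega>b * bloch (\<beta> t) 2) * E (mat 1) (pauli 1) t = 0"
    proof (rule has_vector_derivative_unique_on_interval[OF has_vector_derivative_mult[OF D D] _ t])
      show "((\<lambda>_. 1) has_vector_derivative 0) (at t)" by (rule has_vector_derivative_const)
      show "E (mat 1) (pauli 1) s * E (mat 1) (pauli 1) s = 1" if "s \<in> {c<..<d}" for s
        using y1[OF that] by (simp only: bloch_\<beta>[OF I(2)[OF that]])
    qed
    then have "bloch (\<beta> t) 1 * (\<omega>b * bloch (\<beta> t) 2) = 0"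
      by (auto simp add: bloch_\<beta>[OF I(2)[OF t], of 1])
    moreover have "bloch (\<beta> t) 1 \<noteq> 0" using y1[OF t] by auto
    ultimately show ?thesis using \<omega>b by simp
  qed
  define t where "t = (c + d) / 2"
  have t: "t \<in> {c<..<d}" using \<open>c < d\<close> by (simp add: t_def)
  have "\<omega>b * bloch (\<beta> t) 1 - g * bloch (\<alpha> t) 3 * bloch (\<beta> t) 3 = 0"
  proof (rule has_vector_derivative_unique_on_interval[OF y_deriv_components(2)[OF I(1)[OF t]] _ t])
    show "((\<lambda>_. 0) has_vector_derivative 0) (at t)" by (rule has_vector_derivative_const)
    show "E (mat 1) (pauli 2) s = 0" if "s \<in> {c<..<d}" for s
      using y2[OF that] by (simp only: bloch_\<beta>[OF I(2)[OF that]])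
  qed
  moreover have "bloch (\<beta> t) 3 = 0"
    using purity_bloch[of "\<beta> t"] y1[OF t] y2[OF t]
    by (simp add: pure[OF I(2)[OF t]] trace_marginals[OF I(2)[OF t]] power2_eq_square)
  ultimately have "bloch (\<beta> t) 1 = 0" using \<omega>b by simp
  then show False using y1[OF t] by simp
qed

text \<open>The pole condition holds at some point of every regular interval by
  \<open>y1_not_stuck\<close>, and extends to all times because the Bloch coordinates are
  continuous.\<close>

lemma pole:
  assumes t: "t \<in> {0..\<epsilon>}"
  shows "bloch (\<alpha> t) 1 = 0" "bloch (\<alpha> t) 2 = 0" "(bloch (\<alpha> t) 3)\<^sup>2 = 1"
proof -
  have dense: "\<exists>s\<in>{c<..<d}. bloch (\<alpha> s) 1 = 0 \<and> bloch (\<alpha> s) 2 = 0 \<and> (bloch (\<alpha> s) 3)\<^sup>2 = 1"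
    if cd: "c < d" "{c<..<d} \<subseteq> {0<..<\<epsilon>} - S" for c d
  proof -
    obtain s where s: "s \<in> {c<..<d}" "(bloch (\<beta> s) 1)\<^sup>2 \<noteq> 1"
      using y1_not_stuck[OF cd] by blast
    then have "s \<in> {0<..<\<epsilon>} - S" using cd(2) by blast
    moreover from this have "s \<in> {0..\<epsilon>}" by auto
    ultimately have "bloch (\<alpha> s) 1 = 0 \<and> bloch (\<alpha> s) 2 = 0 \<and> (bloch (\<alpha> s) 3)\<^sup>2 = 1"
      using s(2) by (intro product_preserving_imp_pole[of "\<alpha> s" "\<beta> s"] trace_marginals pure exchange_product)
    then show ?thesis using s(1) by blast
  qed
  note closed = eq_const_if_dense[OF \<epsilon> finite_S _ _ t]
  show "bloch (\<alpha> t) 1 = 0"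
    by (rule closed[OF continuous_bloch_\<alpha>]) (use dense in blast)
  show "bloch (\<alpha> t) 2 = 0"
    by (rule closed[OF continuous_bloch_\<alpha>]) (use dense in blast)
  have "continuous_on {0..\<epsilon>} (\<lambda>t. (bloch (\<alpha> t) 3)\<^sup>2)"
    by (intro continuous_on_power continuous_bloch_\<alpha>)
  then show "(bloch (\<alpha> t) 3)\<^sup>2 = 1"
    by (rule closed) (use dense in blast)
qed

text \<open>A continuous function on an interval with values in a two-point set is constant, so the
  state of A cannot jump between the poles.\<close>

lemma x3_constant:
  obtains x3 where "x3 \<noteq> 0" "\<And>t. t \<in> {0..\<epsilon>} \<Longrightarrow> bloch (\<alpha> t) 3 = x3"
proof -
  have "bloch (\<alpha> t) 3 = 1 \<or> bloch (\<alpha> t) 3 = - 1" if "t \<in> {0..\<epsilon>}" for t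
    using pole(3)[OF that] by (simp only: power2_eq_1_iff)
  then have "(\<lambda>t. bloch (\<alpha> t) 3) ` {0..\<epsilon>} \<subseteq> {1, - 1}" by blast
  then have "finite ((\<lambda>t. bloch (\<alpha> t) 3) ` {0..\<epsilon>})" by (rule finite_subset) simp
  then have "(\<lambda>t. bloch (\<alpha> t) 3) constant_on {0..\<epsilon>}"
    by (intro continuous_finite_range_constant continuous_bloch_\<alpha>) simp_all
  then obtain x3 where x3: "\<And>t. t \<in> {0..\<epsilon>} \<Longrightarrow> bloch (\<alpha> t) 3 = x3"
    unfolding constant_on_def by blast
  moreover have "x3 \<noteq> 0" using x3[of 0] pole(3)[of 0] \<epsilon> by auto
  ultimately show ?thesis using that by blast
qed

text \<open>All Bloch coordinates of \<alpha> are constant and the interaction exerts no torque at a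
  pole, so the local generator alone must leave them fixed.\<close>

lemma stationary:
  assumes t: "t \<in> {0<..<\<epsilon>} - S"
  shows "trace (L t ** pauli i) = 0"
proof -
  have t': "t \<in> {0<..<\<epsilon>}" "t \<in> {0..\<epsilon>}" using t by auto
  obtain x3 where x3: "\<And>t. t \<in> {0..\<epsilon>} \<Longrightarrow> bloch (\<alpha> t) 3 = x3" by (rule x3_constant) blast
  have const: "\<exists>c. \<forall>s\<in>{0..\<epsilon>}. bloch (\<alpha> s) i = c" for i
    using exhaust_3[of i] pole x3 by auto
  then obtain c where c: "\<And>s. s \<in> {0..\<epsilon>} \<Longrightarrow> bloch (\<alpha> s) i = c" by blast
  have "trace (L t ** pauli i) - \<i> * (g / 2) * exchange (\<alpha> t) (\<beta> t) (pauli i) (mat 1) = 0"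
  proof (rule has_vector_derivative_unique_on_interval[OF x_deriv[OF t] _ t'(1)])
    show "((\<lambda>_. c) has_vector_derivative 0) (at t)" by (rule has_vector_derivative_const)
    show "E (pauli i) (mat 1) s = c" if "s \<in> {0<..<\<epsilon>}" for s
      using c[of s] bloch_\<alpha>[of s i] that by simp
  qed
  moreover have "exchange (\<alpha> t) (\<beta> t) (pauli i) (mat 1) = 0"
    using exhaust_3[of i] by (elim disjE) (simp_all only: exchange_simps pole[OF t'(2)] mult_zero_left mult_zero_right)
  ultimately show ?thesis by simp
qed

lemma control_values:
  assumes t: "t \<in> {0<..<\<epsilon>} - S"
  shows "v0 m l 1 + bloch (\<alpha> t) 3 * d_hat m l 1 3 + of_real (u t $ 2) * bloch (\<alpha> t) 3 = 0"
    and "v0 m l 2 + bloch (\<alpha> t) 3 * d_hat m l 2 3 - of_real (u t $ 1) * bloch (\<alpha> t) 3 = 0"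
    and "v0 m l 3 + bloch (\<alpha> t) 3 * d_hat m l 3 3 = 0"
proof -
  have "t \<in> {0..\<epsilon>}" using t by auto
  note P = trace_lindblad_pole[OF trace_marginals(1)[OF this] pole(1,2)[OF this], of \<omega>a "u t" m l]
  show "v0 m l 1 + bloch (\<alpha> t) 3 * d_hat m l 1 3 + of_real (u t $ 2) * bloch (\<alpha> t) 3 = 0"
    "v0 m l 2 + bloch (\<alpha> t) 3 * d_hat m l 2 3 - of_real (u t $ 1) * bloch (\<alpha> t) 3 = 0"
    "v0 m l 3 + bloch (\<alpha> t) 3 * d_hat m l 3 3 = 0"
    using stationary[OF t] unfolding P(1)[symmetric] P(2)[symmetric] P(3)[symmetric] by blast+
qed

section \<open>The four conclusions in terms of \<open>vA\<close> and \<open>vB\<close>\<close>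

lemma vA_bloch: "t \<in> {0..\<epsilon>} \<Longrightarrow> vA (\<rho> t) i = bloch (\<alpha> t) i / 2"
  by (simp add: vA_def bloch_\<alpha> E_def)

lemma vB_bloch: "vB (\<rho> t) j = E (mat 1) (pauli j) t / 2"
  by (simp add: vB_def E_def)

lemma pole_vA:
  assumes "t \<in> {0..\<epsilon>}"
  shows "vA (\<rho> t) 1 = 0 \<and> vA (\<rho> t) 2 = 0 \<and> (vA (\<rho> t) 3)\<^sup>2 = 1 / 4"
  using pole[OF assms] by (simp add: vA_bloch[OF assms] power_divide)

lemma dissipation_constraint:
  assumes t: "t \<in> {0..\<epsilon>}"
  shows "vA (\<rho> t) 3 * d_hat m l 3 3 + v0 m l 3 / 2 = 0"
proof -
  obtain x3 where x3: "\<And>t. t \<in> {0..\<epsilon>} \<Longrightarrow> bloch (\<alpha> t) 3 = x3" by (rule x3_constant) blast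
  \<comment> \<open>The radius 1 is arbitrary: since x3 is constant, a single regular time anywhere
    yields the constraint at every time.\<close>
  obtain c d where "c < d" and cd: "{c<..<d} \<subseteq> {0<..<\<epsilon>} - S"
    using subinterval_avoiding_finite[OF \<epsilon> t zero_less_one finite_S] by metis
  have "(c + d) / 2 \<in> {c<..<d}" using \<open>c < d\<close> by simp
  then have s: "(c + d) / 2 \<in> {0<..<\<epsilon>} - S" using cd by blast
  then have s': "(c + d) / 2 \<in> {0..\<epsilon>}" by auto
  have "v0 m l 3 + x3 * d_hat m l 3 3 = 0"
    using control_values(3)[OF s] unfolding x3[OF s'] .
  then show ?thesis
    by (simp add: vA_bloch[OF t] x3[OF t] field_simps)
qed

text \<open>At regular times \<open>control_values\<close> can be solved for the control, as x3 is
  nonzero. The result does not depend on time, so a continuity point of the control inherits the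
  same value.\<close>

lemma control_formula:
  assumes t: "t \<in> {0..\<epsilon>}" and u: "continuous (at t within {0..\<epsilon>}) u"
  shows "complex_of_real (u t $ 1) = (v0 m l 2 + 2 * vA (\<rho> t) 3 * d_hat m l 2 3) / (2 * vA (\<rho> t) 3)"
    and "complex_of_real (u t $ 2) = - ((v0 m l 1 + 2 * vA (\<rho> t) 3 * d_hat m l 1 3) / (2 * vA (\<rho> t) 3))"
proof -
  obtain x3 where "x3 \<noteq> 0" and x3: "\<And>t. t \<in> {0..\<epsilon>} \<Longrightarrow> bloch (\<alpha> t) 3 = x3"
    by (rule x3_constant) blast
  have v: "2 * vA (\<rho> t) 3 = x3" by (simp add: vA_bloch[OF t] x3[OF t])
  have cont: "continuous (at t within {0..\<epsilon>}) (\<lambda>s. complex_of_real (u s $ i))" for i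
    using u by (intro continuous_intros)
  have I: "s \<in> {0..\<epsilon>}" if "s \<in> {0<..<\<epsilon>} - S" for s using that by auto
  have "complex_of_real (u s $ 1) = (v0 m l 2 + x3 * d_hat m l 2 3) / x3" if "s \<in> {0<..<\<epsilon>} - S" for s
    using control_values(2)[OF that] \<open>x3 \<noteq> 0\<close> unfolding x3[OF I[OF that]] by (simp add: field_simps)
  from eq_const_at_continuity_point[OF \<epsilon> finite_S cont this t]
  show "complex_of_real (u t $ 1) = (v0 m l 2 + 2 * vA (\<rho> t) 3 * d_hat m l 2 3) / (2 * vA (\<rho> t) 3)"
    unfolding v .
  have "complex_of_real (u s $ 2) = - ((v0 m l 1 + x3 * d_hat m l 1 3) / x3)" if "s \<in> {0<..<\<epsilon>} - S" for s
    using control_values(1)[OF that] \<open>x3 \<noteq> 0\<close> unfolding x3[OF I[OF that]]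
    by (simp add: field_simps add_eq_0_iff)
  from eq_const_at_continuity_point[OF \<epsilon> finite_S cont this t]
  show "complex_of_real (u t $ 2) = - ((v0 m l 1 + 2 * vA (\<rho> t) 3 * d_hat m l 1 3) / (2 * vA (\<rho> t) 3))"
    unfolding v .
qed

text \<open>The right-hand sides are continuous, being free of the control, so the equations extend
  across its jumps and to the endpoints. The factor 2 comes from x3 being twice
  \<open>vA (\<rho> t) 3\<close>.\<close>

lemma vB_equation:
  assumes t: "t \<in> {0..\<epsilon>}"
  shows "((\<lambda>s. vB (\<rho> s) 1) has_vector_derivative - complex_of_real \<omega>b * vB (\<rho> t) 2) (at t within {0..\<epsilon>})"
    and "((\<lambda>s. vB (\<rho> s) 2) has_vector_derivative
      complex_of_real \<omega>b * vB (\<rho> t) 1 - 2 * complex_of_real g * vA (\<rho> t) 3 * vB (\<rho> t) 3) (at t within {0..\<epsilon>})"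
    and "((\<lambda>s. vB (\<rho> s) 3) has_vector_derivative
      2 * complex_of_real g * vA (\<rho> t) 3 * vB (\<rho> t) 2) (at t within {0..\<epsilon>})"
proof -
  have B: "continuous_on {0..\<epsilon>} (\<lambda>s. vB (\<rho> s) j)" for j
    unfolding vB_bloch by (intro continuous_intros E_continuous) simp
  have A: "continuous_on {0..\<epsilon>} (\<lambda>s. vA (\<rho> s) 3)"
    unfolding vA_def E_def[symmetric] by (intro continuous_intros E_continuous) simp
  have half: "((\<lambda>s. E P Q s / 2) has_vector_derivative D / 2) (at s)"
    if "(E P Q has_vector_derivative D) (at s)" for P Q D s
    using that by (rule has_vector_derivative_divide)
  have I: "s \<in> {0..\<epsilon>}" if "s \<in> {0<..<\<epsilon>} - S" for s using that by auto
  show "((\<lambda>s. vB (\<rho> s) 1) has_vector_derivative - complex_of_real \<omega>b * vB (\<rho> t) 2) (at t within {0..\<epsilon>})"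
  proof (rule has_vector_derivative_finite_exceptions[OF finite_S B _ _ t])
    show "((\<lambda>s. vB (\<rho> s) 1) has_vector_derivative - complex_of_real \<omega>b * vB (\<rho> s) 2) (at s)"
      if "s \<in> {0<..<\<epsilon>} - S" for s
      using half[OF y_deriv_components(1)[OF that]] by (simp add: vB_bloch bloch_\<beta>[OF I[OF that]])
  qed (intro continuous_intros B)
  show "((\<lambda>s. vB (\<rho> s) 2) has_vector_derivative
      complex_of_real \<omega>b * vB (\<rho> t) 1 - 2 * complex_of_real g * vA (\<rho> t) 3 * vB (\<rho> t) 3) (at t within {0..\<epsilon>})"
  proof (rule has_vector_derivative_finite_exceptions[OF finite_S B _ _ t])
    show "((\<lambda>s. vB (\<rho> s) 2) has_vector_derivative
      complex_of_real \<omega>b * vB (\<rho> s) 1 - 2 * complex_of_real g * vA (\<rho> s) 3 * vB (\<rho> s) 3) (at s)"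
      if "s \<in> {0<..<\<epsilon>} - S" for s
      using half[OF y_deriv_components(2)[OF that]]
      by (simp add: vB_bloch bloch_\<beta>[OF I[OF that]] vA_bloch[OF I[OF that]] diff_divide_distrib)
  qed (intro continuous_intros A B)
  show "((\<lambda>s. vB (\<rho> s) 3) has_vector_derivative
      2 * complex_of_real g * vA (\<rho> t) 3 * vB (\<rho> t) 2) (at t within {0..\<epsilon>})"
  proof (rule has_vector_derivative_finite_exceptions[OF finite_S B _ _ t])
    show "((\<lambda>s. vB (\<rho> s) 3) has_vector_derivative
      2 * complex_of_real g * vA (\<rho> s) 3 * vB (\<rho> s) 2) (at s)" if "s \<in> {0<..<\<epsilon>} - S" for s
      using half[OF y_deriv_components(3)[OF that]]
      by (simp add: vB_bloch bloch_\<beta>[OF I[OF that]] vA_bloch[OF I[OF that]])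
  qed (intro continuous_intros A B)
qed

end

theorem mainTheorem5:
  fixes g \<omega>a \<omega>b \<epsilon> :: real
    and m :: nat and l :: "nat \<Rightarrow> complex^2^2"
    and u :: "real \<Rightarrow> real^3"
    and \<rho> :: "real \<Rightarrow> complex^(2 \<times> 2)^(2 \<times> 2)"
  assumes "g \<noteq> 0" and "\<omega>b \<noteq> 0"
    and "\<forall>k<m. trace (l k) = 0"
    and "\<epsilon> > 0"
    and "piecewise_smooth_on 0 \<epsilon> u"
    and "is_solution \<omega>a \<omega>b ((g / 2) *\<^sub>R kron (pauli 3) (pauli 1)) m l \<epsilon> u \<rho>"
    and "\<rho> 0 \<in> density_matrices"
    and "\<forall>t\<in>{0..\<epsilon>}. trace (ptrace_A (\<rho> t) ** ptrace_A (\<rho> t)) = 1"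
  shows
    "(\<forall>t\<in>{0..\<epsilon>}. vA (\<rho> t) 1 = 0 \<and> vA (\<rho> t) 2 = 0 \<and> (vA (\<rho> t) 3)\<^sup>2 = 1 / 4)
     \<and> (\<forall>t\<in>{0..\<epsilon>}. vA (\<rho> t) 3 * d_hat m l 3 3 + v0 m l 3 / 2 = 0)
     \<and> (\<forall>t\<in>{0..\<epsilon>}. continuous (at t within {0..\<epsilon>}) u \<longrightarrow>
          complex_of_real (u t $ 1)
            = (v0 m l 2 + 2 * vA (\<rho> t) 3 * d_hat m l 2 3) / (2 * vA (\<rho> t) 3)
          \<and> complex_of_real (u t $ 2)
            = - ((v0 m l 1 + 2 * vA (\<rho> t) 3 * d_hat m l 1 3) / (2 * vA (\<rho> t) 3)))
     \<and> (\<forall>t\<in>{0..\<epsilon>}.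
          ((\<lambda>s. vB (\<rho> s) 1) has_vector_derivative
             - complex_of_real \<omega>b * vB (\<rho> t) 2) (at t within {0..\<epsilon>})
          \<and> ((\<lambda>s. vB (\<rho> s) 2) has_vector_derivative
             complex_of_real \<omega>b * vB (\<rho> t) 1
               - 2 * complex_of_real g * vA (\<rho> t) 3 * vB (\<rho> t) 3) (at t within {0..\<epsilon>})
          \<and> ((\<lambda>s. vB (\<rho> s) 3) has_vector_derivative
             2 * complex_of_real g * vA (\<rho> t) 3 * vB (\<rho> t) 2) (at t within {0..\<epsilon>}))"
proof -
  from assms(6) obtain S where S: "finite S" and cont: "continuous_on {0..\<epsilon>} \<rho>"
    and deriv: "\<And>t. t \<in> {0..\<epsilon>} - S \<Longrightarrow> (\<rho> has_vector_derivative
      master_rhs \<omega>a \<omega>b ((g / 2) *\<^sub>R kron (pauli 3) (pauli 1)) m l (u t) (\<rho> t)) (at t within {0..\<epsilon>})"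
    unfolding is_solution_def by blast
  interpret pure_marginal_solution g \<omega>a \<omega>b \<epsilon> m l u \<rho> S
  proof
    show "(\<rho> has_vector_derivative
      master_rhs \<omega>a \<omega>b ((g / 2) *\<^sub>R kron (pauli 3) (pauli 1)) m l (u t) (\<rho> t)) (at t)"
      if "t \<in> {0<..<\<epsilon>} - S" for t
      using deriv[of t] that by (simp add: at_within_Icc_at)
    show "trace (ptrace_A (\<rho> t) ** ptrace_A (\<rho> t)) = 1" if "t \<in> {0..\<epsilon>}" for t
      using assms(8) that by blast
  qed (use assms(1,2,4,7) S cont in auto)
  show ?thesis
    by (intro conjI ballI impI pole_vA dissipation_constraint control_formula vB_equation)
qed

end
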